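(* Let $k$ be an algebraically closed field of characteristic $p\ge3$, let $(\mathfrak{g},[p])$ be a finite-dimensional restricted Lie algebra over $k$, and let $\mathfrak{g}=\mathfrak{g}_0\oplus\bigoplus_{\alpha\in\Phi}\mathfrak{g}_\alpha$ be the root space decomposition of $\mathfrak{g}$ relative to a torus $\mathfrak{t}\subseteq\mathfrak{g}$ of maximal dimension. If the variety $\mathcal{T}_{\mathfrak{g}}(k)$ is irreducible, then $\Phi\cup\{0\}=\mathrm{Lie}_p(\mathfrak{t},k)$, and all root spaces of $\mathfrak{g}$ have the same dimension.
   Context: A torus is an abelian $p$-subalgebra consisting of semisimple elements ($x$ is semisimple if it lies in the $p$-subalgebra generated by $x^{[p]}$); "maximal dimension" means dimension $\mu(\mathfrak{g})$, the maximum of the dimensions of all tori of $\mathfrak{g}$. $\mathfrak{g}_\alpha=\{x\in\mathfrak{g}: [t,x]=\alpha(t)x\ \forall t\in\mathfrak{t}\}$, and $\Phi$ is the set of non-zero $\alpha$ with $\mathfrak{g}_\alpha\neq0$; the root spaces are the $\mathfrak{g}_\alpha$, $\alpha\in\Phi$. $\mathrm{Lie}_p(\mathfrak{t},k)$ is the additive group of homomorphisms $\mathfrak{t}\to k$ of restricted Lie algebras ($k$ with $p$-map $a\mapsto a^p$), i.e. linear forms with $\lambda(t^{[p]})=\lambda(t)^p$. $\mathcal{T}_{\mathfrak{g}}(k)$ is the variety (with Zariski topology from $\mathrm{Hom}_k(\mathfrak{t},\mathfrak{g})$) of injective homomorphisms $\mathfrak{t}\to\mathfrak{g}$ of restricted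 Lie algebras. *)

theory Defs
  imports
    "HOL-Analysis.Abstract_Topology"
    "HOL-Computational_Algebra.Computational_Algebra"
begin

section \<open>Linear maps on a subspace\<close>

definition linear_on ::
    "'a::ab_group_add set \<Rightarrow> ('k::field \<Rightarrow> 'a \<Rightarrow> 'a) \<Rightarrow> ('k \<Rightarrow> 'b::ab_group_add \<Rightarrow> 'b) \<Rightarrow> ('a \<Rightarrow> 'b) \<Rightarrow> bool"
  where "linear_on S s1 s2 f \<longleftrightarrow>
    (\<forall>x\<in>S. \<forall>y\<in>S. f (x + y) = f x + f y) \<and> (\<forall>c. \<forall>x\<in>S. f (s1 c x) = s2 c (f x))"


section \<open>Zariski topology\<close>

inductive_set generated_algebra :: "('v \<Rightarrow> 'k::field) set \<Rightarrow> ('v \<Rightarrow> 'k) set"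
  for L :: "('v \<Rightarrow> 'k) set" where
  gen: "f \<in> L \<Longrightarrow> f \<in> generated_algebra L"
| const: "(\<lambda>_. c) \<in> generated_algebra L"
| add: "f \<in> generated_algebra L \<Longrightarrow> g \<in> generated_algebra L \<Longrightarrow> (\<lambda>v. f v + g v) \<in> generated_algebra L"
| mult: "f \<in> generated_algebra L \<Longrightarrow> g \<in> generated_algebra L \<Longrightarrow> (\<lambda>v. f v * g v) \<in> generated_algebra L"

definition zero_locus :: "'v set \<Rightarrow> ('v \<Rightarrow> 'k::field) set \<Rightarrow> 'v set"
  where "zero_locus V P = {v \<in> V. \<forall>f\<in>P. f v = 0}"

text \<open>The Zariski topology on \<open>V\<close>, where \<open>L\<close> is a set of coordinate functions on \<open>V\<close>.\<close>

definition zariski_topology :: "'v set \<Rightarrow> ('v \<Rightarrow> 'k::field) set \<Rightarrow> 'v topology"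
  where "zariski_topology V L =
    topology (\<lambda>U. \<exists>P\<subseteq>generated_algebra L. U = V - zero_locus V P)"

lemma istopology_zariski:
  "istopology (\<lambda>U. \<exists>P\<subseteq>generated_algebra L. U = V - zero_locus V P)"
  unfolding istopology_def
proof (intro conjI allI impI)
  fix S T
  assume "\<exists>P\<subseteq>generated_algebra L. S = V - zero_locus V P"
    and "\<exists>P\<subseteq>generated_algebra L. T = V - zero_locus V P"
  then obtain P Q where P: "P \<subseteq> generated_algebra L" "S = V - zero_locus V P"
    and Q: "Q \<subseteq> generated_algebra L" "T = V - zero_locus V Q" by blast
  define R where "R = {(\<lambda>v. f v * g v) | f g. f \<in> P \<and> g \<in> Q}"
  have "R \<subseteq> generated_algebra L"
    using P(1) Q(1) by (auto simp: R_def intro!: generated_algebra.mult)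
  moreover have "zero_locus V R = zero_locus V P \<union> zero_locus V Q"
  proof (intro equalityI subsetI)
    fix v assume v: "v \<in> zero_locus V R"
    then have *: "f v * g v = 0" if "f \<in> P" "g \<in> Q" for f g
      using that by (force simp: zero_locus_def R_def)
    show "v \<in> zero_locus V P \<union> zero_locus V Q"
      using v * by (auto simp: zero_locus_def)
  qed (auto simp: zero_locus_def R_def)
  ultimately show "\<exists>P\<subseteq>generated_algebra L. S \<inter> T = V - zero_locus V P"
    using P(2) Q(2) by (intro exI[of _ R]) auto
next
  fix K
  assume "\<forall>U\<in>K. \<exists>P\<subseteq>generated_algebra L. U = V - zero_locus V P"
  then obtain P where P: "\<And>U. U \<in> K \<Longrightarrow> P U \<subseteq> generated_algebra L \<and> U = V - zero_locus V (P U)"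
    by metis
  show "\<exists>P\<subseteq>generated_algebra L. \<Union>K = V - zero_locus V P"
  proof (cases "K = {}")
    case True
    then show ?thesis by (intro exI[of _ "{}"]) (auto simp: zero_locus_def)
  next
    case False
    have "\<Union>K = V - zero_locus V (\<Union>U\<in>K. P U)"
      using P by (fastforce simp: zero_locus_def)
    moreover have "(\<Union>U\<in>K. P U) \<subseteq> generated_algebra L" using P by blast
    ultimately show ?thesis by blast
  qed
qed

lemma openin_zariski:
  "openin (zariski_topology V L) U \<longleftrightarrow> (\<exists>P\<subseteq>generated_algebra L. U = V - zero_locus V P)"
  unfolding zariski_topology_def topology_inverse'[OF istopology_zariski] ..

lemma topspace_zariski [simp]: "topspace (zariski_topology V L) = V"
proof -
  have "zero_locus V {\<lambda>_. 1 :: 'b} = {}" by (auto simp: zero_locus_def)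
  then have "openin (zariski_topology V L) V"
    unfolding openin_zariski by (intro exI[of _ "{\<lambda>_. 1}"]) (auto intro: generated_algebra.const)
  moreover have "U \<subseteq> V" if "openin (zariski_topology V L) U" for U
    using that by (auto simp: openin_zariski)
  ultimately show ?thesis by (metis openin_subset openin_topspace subset_antisym)
qed

lemma closedin_zariski:
  "closedin (zariski_topology V L) C \<longleftrightarrow> (\<exists>P\<subseteq>generated_algebra L. C = zero_locus V P)"
proof -
  have "zero_locus V P \<subseteq> V" for P :: "('a \<Rightarrow> 'b) set" by (auto simp: zero_locus_def)
  then show ?thesis
    unfolding closedin_def openin_zariski topspace_zariski
    by (metis Diff_subset double_diff subset_refl)
qed

definition irreducible_space :: "'a topology \<Rightarrow> bool"
  where "irreducible_space X \<longleftrightarrow> topspace X \<noteq> {} \<and>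
    (\<forall>C D. closedin X C \<and> closedin X D \<and> C \<union> D = topspace X \<longrightarrow> C = topspace X \<or> D = topspace X)"


section \<open>Restricted Lie algebras\<close>

text \<open>Elements of \<open>\<gg> \<otimes> k[\<lambda>]\<close> are represented by polynomials with coefficients in \<open>\<gg>\<close>;
  the following is the operator \<open>ad (\<lambda>x + y)\<close> on them.\<close>

definition ad_poly :: "('g \<Rightarrow> 'g \<Rightarrow> 'g) \<Rightarrow> 'g \<Rightarrow> 'g \<Rightarrow> 'g::ab_group_add poly \<Rightarrow> 'g poly"
  where "ad_poly br x y u = pCons 0 (map_poly (br x) u) + map_poly (br y) u"

text \<open>Jacobson's terms \<open>s\<^sub>i(x, y)\<close>, given by
  \<open>ad (\<lambda>x + y)\<^bsup>p-1\<^esup> x = (\<Sum>i=1..p-1. i s\<^sub>i(x, y) \<lambda>\<^bsup>i-1\<^esup>)\<close> with \<open>p\<close> the characteristic of \<open>k\<close>.\<close>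

definition jacobson_term ::
    "('k::field \<Rightarrow> 'g \<Rightarrow> 'g) \<Rightarrow> ('g \<Rightarrow> 'g \<Rightarrow> 'g) \<Rightarrow> nat \<Rightarrow> 'g \<Rightarrow> 'g \<Rightarrow> 'g::ab_group_add"
  where "jacobson_term scale br i x y =
    scale (inverse (of_nat i)) (coeff ((ad_poly br x y ^^ (CHAR('k) - 1)) [:x:]) (i - 1))"

locale restricted_lie_algebra = vector_space scale
  for scale :: "'k::field \<Rightarrow> 'g::ab_group_add \<Rightarrow> 'g" +
  fixes bracket :: "'g \<Rightarrow> 'g \<Rightarrow> 'g"
    and pmap :: "'g \<Rightarrow> 'g"
  assumes char_pos: "CHAR('k) > 0"
    and bracket_linear_right: "Vector_Spaces.linear scale scale (\<lambda>y. bracket x y)"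
    and bracket_linear_left: "Vector_Spaces.linear scale scale (\<lambda>x. bracket x y)"
    and bracket_self: "bracket x x = 0"
    and jacobi: "bracket x (bracket y z) + bracket y (bracket z x) + bracket z (bracket x y) = 0"
    and pmap_ad: "bracket (pmap x) y = (bracket x ^^ CHAR('k)) y"
    and pmap_scale: "pmap (scale c x) = scale (c ^ CHAR('k)) (pmap x)"
    and pmap_add: "pmap (x + y) = pmap x + pmap y + (\<Sum>i=1..<CHAR('k). jacobson_term scale bracket i x y)"
begin

definition p_subalgebra :: "'g set \<Rightarrow> bool"
  where "p_subalgebra S \<longleftrightarrow> subspace S \<and> (\<forall>x\<in>S. \<forall>y\<in>S. bracket x y \<in> S) \<and> (\<forall>x\<in>S. pmap x \<in> S)"

definition semisimple :: "'g \<Rightarrow> bool"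
  where "semisimple x \<longleftrightarrow> x \<in> p_subalgebra hull {pmap x}"

definition torus :: "'g set \<Rightarrow> bool"
  where "torus T \<longleftrightarrow> p_subalgebra T \<and> (\<forall>x\<in>T. \<forall>y\<in>T. bracket x y = 0) \<and> (\<forall>x\<in>T. semisimple x)"

text \<open>Meaningful for finite-dimensional \<open>\<gg>\<close>, where the set of dimensions is finite.\<close>

definition max_torus_dim :: nat
  where "max_torus_dim = Max (dim ` {T. torus T})"

definition torus_of_max_dim :: "'g set \<Rightarrow> bool"
  where "torus_of_max_dim T \<longleftrightarrow> torus T \<and> dim T = max_torus_dim"

text \<open>Functions defined on \<open>T\<close> only are represented by extensional functions, so that
  equality of such functions is equality on \<open>T\<close>.\<close>

definition dual_space :: "'g set \<Rightarrow> ('g \<Rightarrow> 'k) set"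
  where "dual_space T = {a \<in> extensional T. linear_on T scale (*) a}"

definition root_space :: "'g set \<Rightarrow> ('g \<Rightarrow> 'k) \<Rightarrow> 'g set"
  where "root_space T a = {x. \<forall>t\<in>T. bracket t x = scale (a t) x}"

definition roots :: "'g set \<Rightarrow> ('g \<Rightarrow> 'k) set"
  where "roots T = {a \<in> dual_space T. a \<noteq> (\<lambda>t\<in>T. 0) \<and> root_space T a \<noteq> {0}}"

text \<open>The bracket condition is void here: \<open>k\<close> is abelian and this is used for abelian \<open>T\<close>.\<close>

definition Lie_p :: "'g set \<Rightarrow> ('g \<Rightarrow> 'k) set"
  where "Lie_p T = {a \<in> dual_space T. \<forall>t\<in>T. a (pmap t) = a t ^ CHAR('k)}"

definition Hom_k :: "'g set \<Rightarrow> ('g \<Rightarrow> 'g) set"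
  where "Hom_k T = {f \<in> extensional T. linear_on T scale scale f}"

text \<open>The matrix coefficients; they span the linear forms on the vector space \<open>Hom_k T\<close>.\<close>

definition matrix_coeffs :: "'g set \<Rightarrow> (('g \<Rightarrow> 'g) \<Rightarrow> 'k) set"
  where "matrix_coeffs T = {(\<lambda>f. \<xi> (f t)) | \<xi> t. Vector_Spaces.linear scale (*) \<xi> \<and> t \<in> T}"

definition torus_embeddings :: "'g set \<Rightarrow> ('g \<Rightarrow> 'g) set"
  where "torus_embeddings T = {f \<in> Hom_k T. inj_on f T \<and>
    (\<forall>x\<in>T. \<forall>y\<in>T. f (bracket x y) = bracket (f x) (f y)) \<and>
    (\<forall>x\<in>T. f (pmap x) = pmap (f x))}"

definition torus_variety :: "'g set \<Rightarrow> ('g \<Rightarrow> 'g) topology"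
  where "torus_variety T =
    subtopology (zariski_topology (Hom_k T) (matrix_coeffs T)) (torus_embeddings T)"

end

end

theory Submission
  imports Defs
begin

text \<open>
  Write \<open>\<t>\<close> for the torus \<open>T\<close> and let \<open>f\<close> range over the embeddings of \<open>\<t>\<close>. Each \<open>f\<close> turns \<open>\<gg>\<close>
  into a sum of weight spaces \<open>\<gg>\<^bsup>f\<^esup>\<^sub>\<alpha> = {x. [f t, x] = \<alpha>(t) x}\<close>, where \<open>\<alpha>\<close> ranges over the same
  finite set \<open>Lie\<^sub>p(\<t>, k)\<close> for all \<open>f\<close>. The key point is that \<open>dim \<gg>\<^bsup>f\<^esup>\<^sub>\<alpha>\<close> is locally constant in
  \<open>f\<close>: the projection onto \<open>\<gg>\<^bsup>f\<^esup>\<^sub>\<alpha>\<close> is a polynomial in \<open>f\<close>, so a basis of weight vectors for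
  \<open>f\<^sub>0\<close> is carried to weight vectors for every \<open>f\<close>, and these remain linearly independent on a
  Zariski-neighbourhood of \<open>f\<^sub>0\<close> (\<open>dim_weight_space_locally_constant\<close>). Two nonempty open
  subsets of an irreducible space meet, so for irreducible \<open>\<T>\<close> the dimension does not depend on
  \<open>f\<close> at all (\<open>dim_weight_space_constant\<close>).

  Apply this to the inclusion and to an automorphism \<open>\<sigma>\<close> of \<open>\<t>\<close>: since
  \<open>\<gg>\<^bsup>\<sigma>\<^esup>\<^sub>\<beta> = \<gg>\<^sub>\<alpha>\<close> whenever \<open>\<beta> = \<alpha> \<circ> \<sigma>\<close>, the spaces \<open>\<gg>\<^sub>\<alpha>\<close> and \<open>\<gg>\<^sub>\<beta>\<close> have the same dimension. The
  automorphisms act transitively on \<open>Lie\<^sub>p(\<t>, k) - {0}\<close>; in fact a single transvection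
  \<open>t \<mapsto> t + (\<beta> - \<alpha>)(t) u\<close> with \<open>u\<close> toral, \<open>\<alpha>(u) = 1\<close> and \<open>\<beta>(u) \<noteq> 0\<close> moves \<open>\<alpha>\<close> to \<open>\<beta>\<close>
  (\<open>dim_root_space_eq\<close>). Such a \<open>u\<close> exists because over an algebraically closed field a torus is
  spanned by its toral elements (\<open>torus_eq_span_toral\<close>). Hence either every nonzero element of
  \<open>Lie\<^sub>p(\<t>, k)\<close> is a root, with one common dimension, or there are no roots.

  If there are no roots, \<open>\<t>\<close> is central. Then \<open>\<t>\<close> together with \<open>f(\<t>)\<close> spans a torus, so
  \<open>f(\<t>) \<subseteq> \<t>\<close> by maximality of the dimension, and for toral \<open>h \<in> \<t>\<close> and \<open>\<alpha> \<in> Lie\<^sub>p(\<t>, k)\<close>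
  the function \<open>f \<mapsto> \<alpha>(f h)\<close> takes values in the prime field. On an irreducible
  space such a function is constant, but if \<open>\<alpha>(h) \<noteq> 0\<close> and \<open>p \<ge> 3\<close> it separates the embeddings
  \<open>id\<close> and \<open>-id\<close>. So \<open>Lie\<^sub>p(\<t>, k) = 0\<close> in this case (\<open>central_torus_reducible\<close>).
\<close>

section \<open>Power sums over the prime field\<close>

text \<open>The power sums of degree below \<open>j\<close> vanish by induction, so expanding the telescoping sum of
\<open>(n + 1)\<^bsup>j+1\<^esup> - n\<^bsup>j+1\<^esup>\<close>, whose value \<open>p\<^bsup>j+1\<^esup>\<close> vanishes, leaves \<open>j + 1\<close> times the \<open>j\<close>-th power
sum; and \<open>j + 1 < p\<close> is invertible. The convention \<open>0\<^sup>0 = 1\<close> makes the case \<open>j = 0\<close> correct.\<close>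

lemma power_sum_prime_field:
  assumes "CHAR('k::field) > 0" "j < CHAR('k) - 1"
  shows "(\<Sum>n<CHAR('k). (of_nat n :: 'k) ^ j) = 0"
  using assms(2)
proof (induction j rule: less_induct)
  case (less j)
  let ?p = "CHAR('k)"
  have "(\<Sum>n<?p. (of_nat (Suc n) :: 'k) ^ Suc j - of_nat n ^ Suc j) = of_nat ?p ^ Suc j - of_nat 0 ^ Suc j"
    by (rule sum_lessThan_telescope)
  then have "0 = (\<Sum>n<?p. (of_nat (Suc n) :: 'k) ^ Suc j - of_nat n ^ Suc j)" by simp
  also have "\<dots> = (\<Sum>n<?p. \<Sum>l\<le>j. of_nat (Suc j choose l) * of_nat n ^ l)"
  proof (rule sum.cong)
    fix n
    have "(of_nat (Suc n) :: 'k) ^ Suc j = (of_nat n + 1) ^ Suc j" by (simp add: add.commute)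
    also have "\<dots> = (\<Sum>l\<le>Suc j. of_nat (Suc j choose l) * of_nat n ^ l)"
      by (subst binomial_ring) simp
    finally show "(of_nat (Suc n) :: 'k) ^ Suc j - of_nat n ^ Suc j
        = (\<Sum>l\<le>j. of_nat (Suc j choose l) * of_nat n ^ l)"
      by (simp del: power_Suc)
  qed simp
  also have "\<dots> = (\<Sum>l\<le>j. of_nat (Suc j choose l) * (\<Sum>n<?p. (of_nat n :: 'k) ^ l))"
    by (subst sum.swap) (simp add: sum_distrib_left)
  also have "\<dots> = (\<Sum>l\<in>{j}. of_nat (Suc j choose l) * (\<Sum>n<?p. (of_nat n :: 'k) ^ l))"
    using less by (intro sum.mono_neutral_right) auto
  also have "\<dots> = of_nat (Suc j) * (\<Sum>n<?p. (of_nat n :: 'k) ^ j)"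
    by (simp only: binomial_Suc_n sum.insert finite.emptyI empty_iff not_False_eq_True sum.empty add_0_right)
  finally have "(of_nat (Suc j) :: 'k) * (\<Sum>n<?p. of_nat n ^ j) = 0" by simp
  moreover have "(of_nat (Suc j) :: 'k) \<noteq> 0"
  proof -
    have "\<not> ?p dvd Suc j" using less.prems by (auto dest: dvd_imp_le)
    then show ?thesis by (simp only: of_nat_eq_0_iff_char_dvd not_False_eq_True)
  qed
  ultimately show ?case by simp
qed

section \<open>Eigenspaces of toral elements\<close>

context restricted_lie_algebra
begin

lemma prime_char: "prime CHAR('k)"
  using char_pos by (rule prime_CHAR_semidom)

lemma char_gt_1: "CHAR('k) > 1"
  using prime_char by (rule prime_gt_1_nat)

lemma frobenius_add: "(a + b :: 'k) ^ CHAR('k) = a ^ CHAR('k) + b ^ CHAR('k)"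
  by (rule freshmans_dream) (auto simp: prime_char)

lemma frobenius_of_nat: "(of_nat n :: 'k) ^ CHAR('k) = of_nat n"
  using char_pos by (induction n) (simp_all add: frobenius_add)

lemma frobenius_minus: "(- a :: 'k) ^ CHAR('k) = - (a ^ CHAR('k))"
  by (rule minus_power_prime_CHAR) (auto simp: prime_char)

sublocale ad: Vector_Spaces.linear scale scale "\<lambda>y. bracket x y" for x
  by (rule bracket_linear_right)

sublocale bracket_left: Vector_Spaces.linear scale scale "\<lambda>x. bracket x y" for y
  by (rule bracket_linear_left)

lemma bracket_anticomm: "bracket x y = - bracket y x"
proof -
  have "0 = bracket (x + y) (x + y)" by (simp only: bracket_self)
  also have "\<dots> = bracket y x + bracket x y"
    unfolding ad.add bracket_left.add by (simp add: bracket_self)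
  finally show ?thesis by (metis eq_neg_iff_add_eq_0 add.commute)
qed

text \<open>By the Jacobi identity, the commutator of the two adjoint operators is \<open>ad [x, y]\<close>.\<close>

lemma bracket_commuting:
  assumes "bracket x y = 0"
  shows "bracket x (bracket y z) = bracket y (bracket x z)"
proof -
  have "bracket x (bracket y z) + bracket y (bracket z x) = 0"
    using jacobi[of x y z] assms by (simp add: ad.zero)
  then show ?thesis
    by (subst (asm) bracket_anticomm[of z x]) (simp add: ad.neg)
qed

lemma ad_funpow_scale: "(bracket x ^^ n) (scale c y) = scale c ((bracket x ^^ n) y)"
  by (induction n) (simp_all add: ad.scale)

lemma ad_funpow_commute:
  assumes "bracket h' h = 0"
  shows "bracket h' ((bracket h ^^ i) x) = (bracket h ^^ i) (bracket h' x)"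
  by (induction i) (simp_all add: bracket_commuting[OF assms])

definition toral :: "'g \<Rightarrow> bool"
  where "toral h \<longleftrightarrow> pmap h = h"

text \<open>For \<open>s\<close> in the prime field, \<open>[s = 0] - (\<Sum>i=1..p-1. s\<^bsup>p-1-i\<^esup> X\<^bsup>i\<^esup>)\<close> is the polynomial
\<open>1 - (X - s)\<^bsup>p-1\<^esup>\<close>, which is \<open>1\<close> at \<open>s\<close> and \<open>0\<close> at the other elements of the prime field. For
toral \<open>h\<close> the operator \<open>ad h\<close> satisfies \<open>(ad h)\<^bsup>p\<^esup> = ad h\<close>, and substituting \<open>ad h\<close> for \<open>X\<close>
gives the projection onto its \<open>s\<close>-eigenspace. That this is a polynomial in \<open>h\<close>, and hence varies
algebraically with \<open>h\<close>, is what the whole proof rests on.\<close>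

definition eigenproj :: "'g \<Rightarrow> 'k \<Rightarrow> 'g \<Rightarrow> 'g"
  where "eigenproj h s x = (if s = 0 then x else 0)
    - (\<Sum>i = 1..<CHAR('k). scale (s ^ (CHAR('k) - 1 - i)) ((bracket h ^^ i) x))"

lemma eigenproj_commute:
  assumes "bracket h' h = 0"
  shows "bracket h' (eigenproj h s x) = eigenproj h s (bracket h' x)"
  by (simp add: eigenproj_def ad.diff ad.sum ad.scale ad.zero ad_funpow_commute[OF assms])

lemma eigenproj_scale: "eigenproj h s (scale c x) = scale c (eigenproj h s x)"
  by (simp add: eigenproj_def ad_funpow_scale scale_right_diff_distrib scale_sum_right
      mult.commute)

lemma prime_field_power:
  assumes "s ^ CHAR('k) = (s :: 'k)" "s \<noteq> 0"
  shows "s ^ (CHAR('k) - 1) = 1"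
proof -
  have "s * s ^ (CHAR('k) - 1) = s * 1"
    using assms char_pos by (metis mult.right_neutral power_eq_if less_numeral_extra(3))
  then show ?thesis using assms(2) by (subst (asm) mult_cancel_left) simp
qed

text \<open>Applying \<open>ad h - s\<close> to \<open>\<Sum>i=1..p-1. s\<^bsup>p-1-i\<^esup> (ad h)\<^bsup>i\<^esup>\<close> telescopes to \<open>(ad h)\<^bsup>p\<^esup> - s\<^bsup>p-1\<^esup> ad h\<close>.
Here \<open>(ad h)\<^bsup>p\<^esup> = ad h\<close> since \<open>h\<close> is toral, and \<open>s\<^bsup>p-1\<^esup>\<close> is \<open>0\<close> or \<open>1\<close>.\<close>

lemma bracket_eigenproj:
  assumes "toral h" "s ^ CHAR('k) = s"
  shows "bracket h (eigenproj h s x) = scale s (eigenproj h s x)"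
proof -
  let ?p = "CHAR('k)"
  define F where "F i = (bracket h ^^ i) x" for i
  define S where "S = (\<Sum>i = 1..<?p. scale (s ^ (?p - 1 - i)) (F i))"
  have Fp: "F ?p = F 1"
    using assms(1) pmap_ad[of h x] by (simp add: F_def toral_def)
  have "bracket h S - scale s S
      = (\<Sum>i = 1..<?p. scale (s ^ (?p - Suc i)) (F (Suc i)) - scale (s ^ (?p - i)) (F i))"
    unfolding S_def ad.sum scale_sum_right sum_subtractf[symmetric]
  proof (rule sum.cong)
    fix i assume i: "i \<in> {1..<?p}"
    have "bracket h (F i) = F (Suc i)" by (simp add: F_def)
    moreover have "s * s ^ (?p - 1 - i) = s ^ (?p - i)"
      using i by (simp add: power_Suc[symmetric] Suc_diff_Suc del: power_Suc)
    ultimately show "bracket h (scale (s ^ (?p - 1 - i)) (F i)) - scale s (scale (s ^ (?p - 1 - i)) (F i))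
        = scale (s ^ (?p - Suc i)) (F (Suc i)) - scale (s ^ (?p - i)) (F i)"
      by (simp add: ad.scale)
  qed simp
  also have "\<dots> = F ?p - scale (s ^ (?p - 1)) (F 1)"
    using char_gt_1 by (subst sum_Suc_diff') auto
  finally have S: "bracket h S = scale s S + F 1 - scale (s ^ (?p - 1)) (F 1)"
    by (simp add: Fp algebra_simps)
  have E: "eigenproj h s x = (if s = 0 then x else 0) - S"
    by (simp add: eigenproj_def S_def F_def)
  show ?thesis
  proof (cases "s = 0")
    case True
    have "(0 :: 'k) ^ (?p - 1) = 0" using char_gt_1 by (simp add: zero_power)
    then show ?thesis using S E True by (simp add: ad.diff F_def)
  next
    case False
    then show ?thesis using S prime_field_power[OF assms(2)] by (simp add: E ad.neg)
  qed
qed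

lemma eigenproj_eigenvector:
  assumes "s ^ CHAR('k) = s" "bracket h x = scale s x"
  shows "eigenproj h s x = x"
proof -
  let ?p = "CHAR('k)"
  have F: "(bracket h ^^ i) x = scale (s ^ i) x" for i
    by (induction i) (simp_all add: ad.scale assms(2) mult.commute)
  have "(\<Sum>i = 1..<?p. scale (s ^ (?p - 1 - i)) ((bracket h ^^ i) x))
      = (\<Sum>i = 1..<?p. scale (s ^ (?p - 1)) x)"
    by (rule sum.cong) (auto simp: F power_add[symmetric])
  also have "\<dots> = scale (of_nat (?p - 1) * s ^ (?p - 1)) x"
    by (simp add: scale_sum_left[symmetric])
  also have "of_nat (?p - 1) = (- 1 :: 'k)"
    using char_pos by (simp add: of_nat_diff)
  finally show ?thesis
    using char_gt_1 prime_field_power[OF assms(1)] by (simp add: eigenproj_def)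
qed

text \<open>The coefficient of \<open>(ad h)\<^bsup>i\<^esup>\<close> in the sum is a power sum of degree \<open>p - 1 - i < p - 1\<close> over the
prime field. So every vector is a sum of eigenvectors of \<open>ad h\<close> if \<open>h\<close> is toral.\<close>

lemma sum_eigenproj: "(\<Sum>n<CHAR('k). eigenproj h (of_nat n) x) = x"
proof -
  let ?p = "CHAR('k)"
  have n0: "(of_nat n :: 'k) = 0 \<longleftrightarrow> n = 0" if "n < ?p" for n
    using that by (auto simp: of_nat_eq_0_iff_char_dvd dest: dvd_imp_le)
  have "(\<Sum>n<?p. if (of_nat n :: 'k) = 0 then x else 0) = (\<Sum>n<?p. if n = 0 then x else 0)"
    by (rule sum.cong) (simp_all add: n0)
  also have "\<dots> = x" using char_pos by simp
  moreover have "(\<Sum>n<?p. \<Sum>i = 1..<?p. scale (of_nat n ^ (?p - 1 - i)) ((bracket h ^^ i) x))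
      = (\<Sum>i = 1..<?p. scale (\<Sum>n<?p. of_nat n ^ (?p - 1 - i)) ((bracket h ^^ i) x))"
    by (subst sum.swap) (simp add: scale_sum_left)
  moreover have "\<dots> = 0"
    by (rule sum.neutral) (use char_gt_1 in \<open>auto intro!: power_sum_prime_field\<close>)
  ultimately show ?thesis
    by (simp add: eigenproj_def sum_subtractf)
qed

text \<open>One toral element is treated at a time: the projections onto the eigenspaces of the new element
commute with the adjoint operators of the old ones, hence split a simultaneous eigenvector into
simultaneous eigenvectors.\<close>

lemma simultaneous_eigenvectors_span:
  assumes "finite S" "\<And>h. h \<in> S \<Longrightarrow> toral h" "\<And>h h'. h \<in> S \<Longrightarrow> h' \<in> S \<Longrightarrow> bracket h h' = 0"
  shows "span {y. \<forall>h\<in>S. \<exists>s. s ^ CHAR('k) = s \<and> bracket h y = scale s y} = UNIV"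
  using assms
proof (induction S rule: finite_induct)
  case empty
  show ?case by simp
next
  case (insert h S)
  define V where "V = span {y. \<forall>h\<in>insert h S. \<exists>s. s ^ CHAR('k) = s \<and> bracket h y = scale s y}"
  have "y \<in> V" if y: "\<forall>h\<in>S. \<exists>s. s ^ CHAR('k) = s \<and> bracket h y = scale s y" for y
  proof -
    have "eigenproj h (of_nat n) y \<in> V" for n
    proof -
      have "\<exists>s. s ^ CHAR('k) = s \<and> bracket h' (eigenproj h (of_nat n) y) = scale s (eigenproj h (of_nat n) y)"
        if "h' \<in> S" for h'
      proof -
        obtain s where "s ^ CHAR('k) = s" "bracket h' y = scale s y" using y \<open>h' \<in> S\<close> by blast
        moreover have "bracket h' h = 0" using insert.prems(2) that by simp
        ultimately show ?thesis by (metis eigenproj_commute eigenproj_scale)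
      qed
      moreover have "bracket h (eigenproj h (of_nat n) y) = scale (of_nat n) (eigenproj h (of_nat n) y)"
        using insert.prems(1) by (intro bracket_eigenproj) (simp_all add: frobenius_of_nat)
      ultimately show ?thesis
        unfolding V_def by (intro span_base) (use frobenius_of_nat in auto)
    qed
    then have "(\<Sum>n<CHAR('k). eigenproj h (of_nat n) y) \<in> V"
      unfolding V_def by (intro span_sum)
    then show ?thesis by (simp add: sum_eigenproj)
  qed
  then have "span {y. \<forall>h\<in>S. \<exists>s. s ^ CHAR('k) = s \<and> bracket h y = scale s y} \<subseteq> V"
    by (intro span_minimal) (auto simp: V_def)
  moreover have "span {y. \<forall>h\<in>S. \<exists>s. s ^ CHAR('k) = s \<and> bracket h y = scale s y} = UNIV"
    using insert by auto
  ultimately show ?case unfolding V_def by auto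
qed

section \<open>Commuting elements\<close>

text \<open>The operator \<open>ad (\<lambda>x + y)\<close> annihilates the constant polynomial \<open>x\<close>, because \<open>[x, x] = [y, x] = 0\<close>,
and it is applied at least once because \<open>p - 1 > 0\<close>.\<close>

lemma jacobson_term_commuting:
  assumes "bracket x y = 0"
  shows "jacobson_term scale bracket i x y = 0"
proof -
  have yx: "bracket y x = 0" using assms bracket_anticomm[of y x] by simp
  have zero: "(ad_poly bracket x y ^^ n) 0 = 0" for n
    by (induction n) (simp_all add: ad_poly_def)
  have "ad_poly bracket x y [:x:] = 0"
    by (simp add: ad_poly_def map_poly_pCons bracket_self yx)
  moreover have "CHAR('k) - 1 = Suc (CHAR('k) - 2)" using char_gt_1 by simp
  ultimately have "(ad_poly bracket x y ^^ (CHAR('k) - 1)) [:x:] = 0"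
    by (simp only: funpow_Suc_right o_def zero)
  then show ?thesis by (simp add: jacobson_term_def)
qed

lemma pmap_add_commuting: "bracket x y = 0 \<Longrightarrow> pmap (x + y) = pmap x + pmap y"
  by (simp add: pmap_add jacobson_term_commuting)

lemma pmap_zero: "pmap 0 = 0"
  using pmap_scale[of 0 0] char_pos by (simp add: zero_power)

definition commuting :: "'g set \<Rightarrow> bool"
  where "commuting S \<longleftrightarrow> (\<forall>x\<in>S. \<forall>y\<in>S. bracket x y = 0)"

lemma commutingD: "commuting S \<Longrightarrow> x \<in> S \<Longrightarrow> y \<in> S \<Longrightarrow> bracket x y = 0"
  unfolding commuting_def by blast

lemma commuting_subset: "commuting S \<Longrightarrow> R \<subseteq> S \<Longrightarrow> commuting R"
  unfolding commuting_def by blast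

lemma commuting_span:
  assumes "commuting S"
  shows "commuting (span S)"
proof -
  have 1: "bracket h y = 0" if "h \<in> S" "y \<in> span S" for h y
    using that(2)
    by (induction rule: span_induct_alt)
      (simp_all add: ad.zero ad.add ad.scale commutingD[OF assms that(1)])
  have "bracket x y = 0" if "x \<in> span S" "y \<in> span S" for x y
    using that(1)
    by (induction rule: span_induct_alt)
      (simp_all add: bracket_left.zero bracket_left.add bracket_left.scale 1 that(2))
  then show ?thesis by (simp add: commuting_def)
qed

lemma pmap_sum_commuting:
  assumes "finite S" "\<And>h h'. h \<in> S \<Longrightarrow> h' \<in> S \<Longrightarrow> bracket (g h) (g h') = 0"
  shows "pmap (\<Sum>h\<in>S. g h) = (\<Sum>h\<in>S. pmap (g h))"
  using assms
proof (induction S rule: finite_induct)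
  case (insert h S)
  have "bracket (g h) (\<Sum>h\<in>S. g h) = 0"
    using insert by (simp add: ad.sum)
  then show ?case using insert by (simp add: pmap_add_commuting)
qed (simp add: pmap_zero)

end

section \<open>Semilinear equations over an algebraically closed field\<close>

text \<open>Solving these Artin-Schreier equations makes it possible to correct a vector that is fixed by the
\<open>p\<close>-map only modulo a span of toral elements.\<close>

lemma artin_schreier_root:
  fixes c :: "'k::alg_closed_field"
  assumes "p > 1"
  shows "\<exists>d. d ^ p - d = c"
proof -
  define P :: "'k poly" where "P = monom 1 p - monom 1 1 - [:c:]"
  have "coeff P p = 1" using assms by (cases p) (auto simp: P_def coeff_pCons split: nat.split)
  then have "degree P > 0" using le_degree[of P p] assms by force
  then obtain d where "poly P d = 0" using alg_closed_imp_poly_has_root by blast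
  then show ?thesis by (auto simp: P_def poly_monom algebra_simps intro: exI[of _ d])
qed

text \<open>Let \<open>\<phi>\<close> be a \<open>p\<close>-semilinear operator with \<open>\<phi>\<^bsup>n+1\<^esup> x = (\<Sum>i\<le>n. a\<^sub>i \<phi>\<^bsup>i\<^esup> x)\<close>. Comparing coefficients in
\<open>\<phi> y = y\<close> for \<open>y = (\<Sum>i\<le>n. b\<^sub>i \<phi>\<^bsup>i\<^esup> x)\<close> gives this recurrence. It expresses all \<open>b\<^sub>i\<close> as polynomials
\<open>B\<^sub>i\<close> in the last coefficient \<open>t = b\<^sub>n\<close>, so what remains to be solved is \<open>B\<^sub>n(t) = t\<close>. All \<open>B\<^sub>i\<close> are divisible by
\<open>t\<^sup>2\<close>, and \<open>B\<^sub>n\<close> is nonzero as soon as one of the \<open>a\<^sub>i\<close> is nonzero; dividing the equation by \<open>t\<close>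
leaves a nonconstant polynomial with constant term \<open>-1\<close>, each root of which is nonzero.\<close>

lemma semilinear_recurrence_root:
  fixes a :: "nat \<Rightarrow> 'k::alg_closed_field"
  assumes p: "p > 1" and a: "\<exists>i\<le>n. a i \<noteq> 0"
  shows "\<exists>b. b n \<noteq> 0 \<and> b 0 = a 0 * b n ^ p \<and> (\<forall>i<n. b (Suc i) = b i ^ p + a (Suc i) * b n ^ p)"
proof -
  define B where "B = rec_nat (monom (a 0) p) (\<lambda>i q. q ^ p + monom (a (Suc i)) p)"
  have B: "B 0 = monom (a 0) p" "B (Suc i) = B i ^ p + monom (a (Suc i)) p" for i
    by (simp_all add: B_def)
  have zero: "(\<forall>i\<le>j. a i = 0) \<Longrightarrow> B j = 0" for j
    using p by (induction j) (simp_all add: B zero_power)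
  \<comment> \<open>A nonzero \<open>B j\<close> has degree at least \<open>p\<close>, so its \<open>p\<close>-th power has degree greater than \<open>p\<close> and
    cannot be cancelled by the monomial of degree \<open>p\<close> that is added to it.\<close>
  have deg: "(\<exists>i\<le>j. a i \<noteq> 0) \<Longrightarrow> degree (B j) \<ge> p" for j
  proof (induction j)
    case 0
    then show ?case by (simp add: B degree_monom_eq)
  next
    case (Suc j)
    show ?case
    proof (cases "\<exists>i\<le>j. a i \<noteq> 0")
      case True
      then have "degree (B j) \<ge> p" by (rule Suc.IH)
      moreover have "degree (B j ^ p) = p * degree (B j)"
        using \<open>p \<le> degree (B j)\<close> p by (intro degree_power_eq) auto
      moreover have "p * 2 \<le> p * degree (B j)"
        using \<open>p \<le> degree (B j)\<close> p by (intro mult_le_mono2) linarith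
      ultimately have lt: "p < degree (B j ^ p)" using p by linarith
      have "degree (monom (a (Suc j)) p) < degree (B j ^ p)"
        using degree_monom_le[of "a (Suc j)" p] lt by linarith
      then have "degree (B (Suc j)) = degree (B j ^ p)"
        by (simp add: B degree_add_eq_left)
      then show ?thesis using lt by simp
    next
      case False
      then have "a (Suc j) \<noteq> 0" "B j = 0" using Suc.prems zero by (auto simp: le_Suc_eq)
      then show ?thesis using p by (simp add: B zero_power degree_monom_eq)
    qed
  qed
  have dvd: "[:0, 1:] ^ 2 dvd B j" for j
  proof -
    have m: "[:0, 1 :: 'k:] ^ 2 dvd monom c p" for c
    proof -
      have "monom c p = [:0, 1:] ^ p * [:c:]"
        by (simp add: monom_altdef mult.commute)
      then show ?thesis using p by (simp add: dvd_smult le_imp_power_dvd)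
    qed
    show ?thesis
    proof (induction j)
      case (Suc j)
      have "B j dvd B j ^ p" using p by (simp add: dvd_power)
      then show ?case using Suc m by (simp add: B dvd_add dvd_trans)
    qed (simp add: B m)
  qed
  then obtain C where C: "B n = [:0, 1:] ^ 2 * C" by (metis dvdE)
  have "B n \<noteq> 0" using deg[OF a] p by force
  then have "C \<noteq> 0" using C by auto
  then have "degree (pCons (-1) C) > 0" by simp
  then obtain t where t: "poly (pCons (-1) C) t = 0" using alg_closed_imp_poly_has_root by blast
  then have t0: "t \<noteq> 0" and tC: "t * poly C t = 1" by auto
  define b where "b i = poly (B i) t" for i
  have "b n = t" using tC by (simp add: b_def C power2_eq_square)
  moreover have "b 0 = a 0 * t ^ p" "b (Suc i) = b i ^ p + a (Suc i) * t ^ p" for i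
    by (simp_all add: b_def B poly_monom)
  ultimately show ?thesis using t0 by blast
qed

section \<open>Tori are the spans of commuting toral elements\<close>

locale alg_closed_restricted_lie_algebra =
  restricted_lie_algebra scale bracket pmap + finite_dimensional_vector_space scale Basis
  for scale :: "'k::alg_closed_field \<Rightarrow> 'g::ab_group_add \<Rightarrow> 'g"
    and bracket :: "'g \<Rightarrow> 'g \<Rightarrow> 'g" and pmap :: "'g \<Rightarrow> 'g" and Basis :: "'g set"
begin

lemma frobenius_surj: "\<exists>d. d ^ CHAR('k) = (c :: 'k)"
  using nth_root_exists[of "CHAR('k)" c] char_pos by auto

text \<open>On commuting elements the \<open>p\<close>-map is additive and \<open>p\<close>-semilinear; since every scalar has a \<open>p\<close>-th
root, the image of a subspace is again a subspace.\<close>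

lemma span_pmap_image:
  assumes "commuting R"
  shows "span (pmap ` R) = pmap ` span R"
proof (intro equalityI subsetI)
  note c = commutingD[OF commuting_span[OF assms]]
  fix y assume "y \<in> span (pmap ` R)"
  then show "y \<in> pmap ` span R"
  proof (induction rule: span_induct_alt)
    case base
    have "pmap 0 = 0" by (rule pmap_zero)
    then show ?case using span_zero[of R] by (metis image_eqI)
  next
    case (step c x y)
    then obtain r w where r: "r \<in> R" "x = pmap r" and w: "w \<in> span R" "y = pmap w" by blast
    obtain d where d: "d ^ CHAR('k) = c" using frobenius_surj by blast
    have "scale d r \<in> span R" using r by (intro span_scale span_base)
    then have "pmap (scale d r + w) = scale c x + y"
      using w r d by (subst pmap_add_commuting) (simp_all add: c pmap_scale)
    moreover have "scale d r + w \<in> span R"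
      using \<open>scale d r \<in> span R\<close> w by (intro span_add)
    ultimately show ?case by (metis image_eqI)
  qed
next
  note c = commutingD[OF commuting_span[OF assms]]
  fix y assume "y \<in> pmap ` span R"
  then obtain x where x: "x \<in> span R" "y = pmap x" by blast
  from x(1) have "x \<in> span R \<and> pmap x \<in> span (pmap ` R)"
  proof (induction rule: span_induct_alt)
    case base
    show ?case by (simp add: pmap_zero span_zero)
  next
    case (step c x y)
    have "scale c x \<in> span R" using step by (intro span_scale span_base)
    then have "pmap (scale c x + y) = scale (c ^ CHAR('k)) (pmap x) + pmap y"
      using step by (subst pmap_add_commuting) (simp_all add: c pmap_scale)
    moreover have "\<dots> \<in> span (pmap ` R)"
      using step by (auto intro!: span_add span_scale intro: span_base)
    ultimately show ?case using span_add[OF \<open>scale c x \<in> span R\<close>, of y] step by auto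
  qed
  then show "y \<in> span (pmap ` R)" using x by simp
qed

definition pmap_orbit :: "'g \<Rightarrow> nat \<Rightarrow> 'g set"
  where "pmap_orbit x j = {(pmap ^^ i) x | i. i \<ge> j}"

lemma pmap_pmap_orbit: "pmap ` pmap_orbit x j = pmap_orbit x (Suc j)"
proof -
  have "pmap ((pmap ^^ i) x) \<in> pmap_orbit x (Suc j)" if "i \<ge> j" for i
    unfolding pmap_orbit_def using that by (intro CollectI exI[of _ "Suc i"]) simp
  moreover have "(pmap ^^ i) x \<in> pmap ` pmap_orbit x j" if "i \<ge> Suc j" for i
    using that by (cases i) (auto simp: pmap_orbit_def)
  ultimately show ?thesis by (auto simp: pmap_orbit_def)
qed

lemma pmap_orbit_subset:
  assumes "\<And>y. y \<in> U \<Longrightarrow> pmap y \<in> U" "(pmap ^^ j) x \<in> U"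
  shows "pmap_orbit x j \<subseteq> U"
proof -
  have "(pmap ^^ (j + n)) x \<in> U" for n
    by (induction n) (use assms in auto)
  then show ?thesis by (force simp: pmap_orbit_def le_iff_add)
qed

lemma pmap_orbit_Suc: "pmap_orbit x j = insert ((pmap ^^ j) x) (pmap_orbit x (Suc j))"
  by (auto simp: pmap_orbit_def) (metis Suc_leI le_neq_implies_less)

lemma span_toral_pmap:
  assumes "commuting S" "\<And>h. h \<in> S \<Longrightarrow> toral h" "x \<in> span S"
  shows "pmap x \<in> span S"
proof -
  have "pmap ` S = S" using assms(2) by (force simp: toral_def)
  then show ?thesis using span_pmap_image[OF assms(1)] assms(3) by auto
qed

text \<open>A linearly independent set of commuting toral elements is fixed by the \<open>p\<close>-map, so the \<open>p\<close>-map is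
injective on its span. For \<open>x\<close> in the span let \<open>W\<^sub>j\<close> be the span of the iterates \<open>\<phi>\<^bsup>i\<^esup> x\<close> with
\<open>i \<ge> j\<close>. The dimensions of the \<open>W\<^sub>j\<close> decrease, so \<open>W\<^sub>j = W\<^bsub>j+1\<^esub>\<close> for some \<open>j\<close>. Thus
\<open>\<phi>\<^bsup>j\<^esup> x \<in> W\<^bsub>j+1\<^esub> = \<phi>\<^bsup>j\<^esup> W\<^sub>1\<close>, and injectivity gives \<open>x \<in> W\<^sub>1\<close>: the element \<open>x\<close> is semisimple.\<close>

lemma torus_span_toral:
  assumes S: "commuting S" "\<And>h. h \<in> S \<Longrightarrow> toral h"
  shows "torus (span S)"
proof -
  obtain B where B: "B \<subseteq> S" "independent B" "span B = span S"
    using maximal_independent_subset[of S] by (metis span_mono span_span subset_antisym)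
  have finB: "finite B" using B(2) by (rule finiteI_independent)
  note c = commutingD[OF commuting_span[OF S(1)]]
  have sub: "p_subalgebra (span S)"
    unfolding p_subalgebra_def using c span_toral_pmap[OF S] by (auto simp: span_zero)
  have inj: "x = y" if xy: "x \<in> span S" "y \<in> span S" "pmap x = pmap y" for x y
  proof -
    define z where "z = x - y"
    have z: "z \<in> span S" using xy by (simp add: z_def span_diff)
    have "pmap (z + y) = pmap z + pmap y" using c[OF z xy(2)] by (rule pmap_add_commuting)
    then have "pmap z = 0" using xy(3) by (simp add: z_def)
    obtain u where u: "z = (\<Sum>b\<in>B. scale (u b) b)"
      using z finB by (auto simp: B(3)[symmetric] span_finite)
    have "pmap z = (\<Sum>b\<in>B. pmap (scale (u b) b))"
      unfolding u using finB B(1) S(1)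
      by (intro pmap_sum_commuting) (auto simp: ad.scale bracket_left.scale commuting_def subset_iff)
    also have "\<dots> = (\<Sum>b\<in>B. scale (u b ^ CHAR('k)) b)"
      using B(1) S(2) by (intro sum.cong) (auto simp: pmap_scale toral_def)
    finally have "(\<Sum>b\<in>B. scale (u b ^ CHAR('k)) b) = 0" using \<open>pmap z = 0\<close> by simp
    then have "u b ^ CHAR('k) = 0" if "b \<in> B" for b
      using independentD[OF B(2) finB subset_refl, of "\<lambda>b. u b ^ CHAR('k)" b] that by simp
    then have "z = 0" unfolding u by (intro sum.neutral) (auto simp: char_pos)
    then show ?thesis by (simp add: z_def)
  qed
  have "semisimple x" if x: "x \<in> span S" for x
  proof -
    have orb: "pmap_orbit x j \<subseteq> span S" for j
    proof -
      have "pmap_orbit x 0 \<subseteq> span S"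
        by (rule pmap_orbit_subset) (use x span_toral_pmap[OF S] in auto)
      then show ?thesis by (auto simp: pmap_orbit_def)
    qed
    obtain j where j: "\<And>i. dim (pmap_orbit x j) \<le> dim (pmap_orbit x i)"
      using ex_has_least_nat[of "\<lambda>_. True" 0 "\<lambda>j. dim (pmap_orbit x j)"] by blast
    have "span (pmap_orbit x (Suc j)) = span (pmap_orbit x j)"
      by (rule subspace_dim_equal) (use j in \<open>auto simp: pmap_orbit_Suc[of x j] intro!: span_mono\<close>)
    then have "(pmap ^^ j) x \<in> span (pmap_orbit x (Suc j))"
      by (simp add: span_base pmap_orbit_Suc[of x j])
    then have "x \<in> span (pmap_orbit x (Suc 0))"
    proof (induction j)
      case (Suc j)
      have "pmap ((pmap ^^ j) x) \<in> pmap ` span (pmap_orbit x (Suc j))"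
        using Suc.prems span_pmap_image[OF commuting_subset[OF commuting_span[OF S(1)] orb[of "Suc j"]]]
        by (simp add: pmap_pmap_orbit)
      then obtain w where w: "w \<in> span (pmap_orbit x (Suc j))" "pmap w = pmap ((pmap ^^ j) x)"
        by (metis imageE)
      have "w \<in> span S" using w(1) span_minimal[OF orb[of "Suc j"] subspace_span] by blast
      moreover have "(pmap ^^ j) x \<in> span S" using orb[of j] pmap_orbit_Suc[of x j] by blast
      ultimately have "(pmap ^^ j) x \<in> span (pmap_orbit x (Suc j))" using inj w by metis
      then show ?case by (rule Suc.IH)
    qed simp
    moreover have "span (pmap_orbit x (Suc 0)) \<subseteq> U" if "p_subalgebra U" "pmap x \<in> U" for U
      using that by (intro span_minimal pmap_orbit_subset) (auto simp: p_subalgebra_def)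
    ultimately show ?thesis by (auto simp: semisimple_def hull_def)
  qed
  then show ?thesis using sub c by (auto simp: torus_def)
qed

text \<open>Suppose \<open>x \<in> T\<close> lies outside the span \<open>S\<close> of the toral elements. Semisimplicity puts \<open>x\<close> into the
span of \<open>{\<phi>\<^bsup>i\<^esup> x | i \<ge> j}\<close> for every \<open>j\<close>, so no iterate \<open>\<phi>\<^bsup>j\<^esup> x\<close> lies in \<open>S\<close>. The first iterate
\<open>\<phi>\<^bsup>m\<^esup> x\<close> that depends on the earlier ones modulo \<open>S\<close> therefore satisfies a relation with a nonzero
coefficient. By \<open>semilinear_recurrence_root\<close> there is \<open>y \<notin> S\<close> in the span of \<open>\<phi>\<^bsup>i\<^esup> x\<close>, \<open>i < m\<close>, with
\<open>\<phi> y - y \<in> S\<close>. On \<open>S\<close> the map \<open>\<phi> - 1\<close> is surjective, by solving one Artin-Schreier equation for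
each toral element, so \<open>y\<close> can be changed by an element of \<open>S\<close> into a toral element outside \<open>S\<close>.\<close>

lemma torus_eq_span_toral:
  assumes T: "torus T"
  shows "T = span {h\<in>T. toral h}"
proof (rule ccontr)
  define H where "H = {h\<in>T. toral h}"
  assume "T \<noteq> span {h\<in>T. toral h}"
  have sT: "subspace T" and pT: "\<And>x. x \<in> T \<Longrightarrow> pmap x \<in> T" and cT: "commuting T"
    and ssT: "\<And>x. x \<in> T \<Longrightarrow> semisimple x"
    using T by (auto simp: torus_def p_subalgebra_def commuting_def)
  have HT: "H \<subseteq> T" by (auto simp: H_def)
  have spH: "span H \<subseteq> T" using HT sT by (rule span_minimal)
  have cH: "commuting H" using cT HT by (rule commuting_subset)
  have pH: "pmap y \<in> span H" if "y \<in> span H" for y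
    using cH that by (intro span_toral_pmap) (auto simp: H_def)
  obtain x where x: "x \<in> T" "x \<notin> span H"
    using \<open>T \<noteq> span {h\<in>T. toral h}\<close> spH by (auto simp: H_def)
  have orbT: "pmap_orbit x j \<subseteq> T" for j
  proof -
    have "pmap_orbit x 0 \<subseteq> T" by (rule pmap_orbit_subset) (use x pT in auto)
    then show ?thesis by (auto simp: pmap_orbit_def)
  qed
  define f where "f i = (pmap ^^ i) x" for i
  have fT: "f i \<in> T" for i using orbT[of i] pmap_orbit_Suc[of x i] by (auto simp: f_def)
  have fS: "pmap (f i) = f (Suc i)" for i by (simp add: f_def)

  have comm_orb: "commuting (pmap_orbit x j)" for j using cT orbT by (rule commuting_subset)
  have span_Suc: "span (pmap_orbit x (Suc j)) = pmap ` span (pmap_orbit x j)" for j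
    using span_pmap_image[OF comm_orb] by (simp add: pmap_pmap_orbit)
  have "x \<in> span (pmap_orbit x 1)"
  proof -
    have "p_subalgebra (span (pmap_orbit x 1))"
      unfolding p_subalgebra_def
    proof (intro conjI ballI)
      fix u v assume "u \<in> span (pmap_orbit x 1)" "v \<in> span (pmap_orbit x 1)"
      then show "bracket u v \<in> span (pmap_orbit x 1)"
        using commutingD[OF commuting_span[OF comm_orb]] by (simp add: span_zero)
    next
      fix u assume "u \<in> span (pmap_orbit x 1)"
      then have "pmap u \<in> span (pmap_orbit x (Suc 1))" using span_Suc by blast
      then show "pmap u \<in> span (pmap_orbit x 1)"
        using span_mono[of "pmap_orbit x (Suc 1)" "pmap_orbit x 1"] pmap_orbit_Suc[of x 1] by blast
    qed simp
    moreover have "pmap x \<in> span (pmap_orbit x 1)"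
      by (rule span_base) (auto simp: pmap_orbit_def intro: exI[of _ 1])
    ultimately show ?thesis using ssT[OF x(1)] by (auto simp: semisimple_def hull_def)
  qed
  then have fj: "f j \<in> span (pmap_orbit x (Suc j))" for j
  proof (induction j)
    case (Suc j)
    then have "pmap (f j) \<in> pmap ` span (pmap_orbit x (Suc j))" by blast
    then show ?case by (simp only: fS span_Suc[symmetric])
  qed (simp add: f_def)
  have xj: "x \<in> span (pmap_orbit x j)" for j
  proof (induction j)
    case (Suc j)
    have "span (pmap_orbit x j) \<subseteq> span (pmap_orbit x (Suc j))"
      using fj[of j] by (intro span_minimal) (auto simp: pmap_orbit_Suc[of x j] f_def intro: span_base)
    then show ?case using Suc by blast
  qed (auto simp: pmap_orbit_def intro!: span_base exI[of _ 0])
  have notin: "f j \<notin> span H" for j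
  proof
    assume "f j \<in> span H"
    then have "pmap_orbit x j \<subseteq> span H" using pH by (intro pmap_orbit_subset) (auto simp: f_def)
    then have "span (pmap_orbit x j) \<subseteq> span H" by (simp add: span_minimal)
    then show False using xj[of j] x by blast
  qed

  \<comment> \<open>\<open>R m\<close>: modulo the toral span, the \<open>m\<close>-th iterate depends on the earlier ones.\<close>
  define R where "R m \<longleftrightarrow> (\<exists>a. f m - (\<Sum>i<m. scale (a i) (f i)) \<in> span H)" for m
  have "\<exists>m. R m"
  proof (rule ccontr)
    assume nR: "\<not> (\<exists>m. R m)"
    have new: "f m \<notin> span (f ` {..<m})" for m
    proof
      assume "f m \<in> span (f ` {..<m})"
      then obtain a where "f m = (\<Sum>i<m. scale (a i) (f i))"
      proof (induction arbitrary: thesis rule: span_induct_alt)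
        case base
        show ?case by (rule base[of "\<lambda>_. 0"]) simp
      next
        case (step c y z)
        then obtain j where "j < m" "y = f j" by auto
        moreover obtain a where "z = (\<Sum>i<m. scale (a i) (f i))" by (rule step.IH)
        ultimately have "scale c y + z = (\<Sum>i<m. scale ((if i = j then c else 0) + a i) (f i))"
          by (simp add: scale_left_distrib sum.distrib if_distrib[of "\<lambda>c. scale c _"] cong: if_cong)
        then show ?case by (rule step.prems)
      qed
      then have "R m" unfolding R_def by (intro exI[of _ a]) (simp add: span_zero)
      then show False using nR by blast
    qed
    have indep: "independent (f ` {..<m}) \<and> card (f ` {..<m}) = m" for m
    proof (induction m)
      case (Suc m)
      have "f m \<notin> f ` {..<m}" using new[of m] span_base[of "f m" "f ` {..<m}"] by argo
      then have "card (insert (f m) (f ` {..<m})) = Suc m" using Suc by simp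
      moreover have "independent (insert (f m) (f ` {..<m}))"
        using Suc new by (intro independent_insertI) auto
      ultimately show ?case by (simp add: lessThan_Suc)
    qed (simp add: independent_empty)
    have "Suc dimension \<le> dim (UNIV :: 'g set)"
      using independent_card_le_dim[OF subset_UNIV, of "f ` {..<Suc dimension}"]
        indep[of "Suc dimension"] by simp
    then show False by (simp add: dimension_def)
  qed
  define m where "m = (LEAST m. R m)"
  have Rm: "R m" and minm: "\<And>i. i < m \<Longrightarrow> \<not> R i"
    using \<open>\<exists>m. R m\<close> by (auto simp: m_def intro: LeastI_ex dest: not_less_Least)
  have "\<not> R 0" using notin[of 0] by (simp add: R_def)
  then obtain n where n: "m = Suc n" using Rm by (cases m) auto
  from Rm obtain a where a: "f m - (\<Sum>i<m. scale (a i) (f i)) \<in> span H" by (auto simp: R_def)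
  define z where "z = f m - (\<Sum>i<m. scale (a i) (f i))"
  have "\<exists>i\<le>n. a i \<noteq> 0"
  proof (rule ccontr)
    assume "\<not> ?thesis"
    then have "(\<Sum>i<m. scale (a i) (f i)) = 0" by (intro sum.neutral) (auto simp: n)
    then show False using a notin[of m] by simp
  qed
  then obtain b where bn: "b n \<noteq> 0" and b0: "b 0 = a 0 * b n ^ CHAR('k)"
    and bS: "\<And>i. i < n \<Longrightarrow> b (Suc i) = b i ^ CHAR('k) + a (Suc i) * b n ^ CHAR('k)"
    using semilinear_recurrence_root[OF char_gt_1] by blast
  define y where "y = (\<Sum>i<m. scale (b i) (f i))"
  have yT: "y \<in> T" unfolding y_def using fT sT by (intro subspace_sum subspace_scale)
  have yH: "y \<notin> span H"
  proof
    assume "y \<in> span H"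
    then have "scale (inverse (b n)) y \<in> span H" by (rule span_scale)
    moreover have "scale (inverse (b n)) y = f n - (\<Sum>i<n. scale (- (inverse (b n) * b i)) (f i))"
      using bn by (simp add: y_def n scale_right_distrib scale_sum_right sum_negf add.commute)
    ultimately have "R n" unfolding R_def by (metis (no_types))
    then show False using minm n by simp
  qed
  have "pmap y = (\<Sum>i<m. pmap (scale (b i) (f i)))"
    unfolding y_def
    by (rule pmap_sum_commuting) (simp_all add: ad.scale bracket_left.scale commutingD[OF cT] fT)
  also have "\<dots> = (\<Sum>i<m. scale (b i ^ CHAR('k)) (f (Suc i)))"
    by (simp add: pmap_scale fS)
  also have "\<dots> = (\<Sum>i<n. scale (b i ^ CHAR('k)) (f (Suc i))) + scale (b n ^ CHAR('k)) (f m)"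
    by (simp add: n)
  also have "f m = z + (\<Sum>i<m. scale (a i) (f i))" by (simp add: z_def)
  also have "scale (b n ^ CHAR('k)) \<dots> = scale (b n ^ CHAR('k)) z + scale (a 0 * b n ^ CHAR('k)) (f 0)
      + (\<Sum>i<n. scale (a (Suc i) * b n ^ CHAR('k)) (f (Suc i)))"
    by (simp only: n sum.lessThan_Suc_shift)
      (simp add: scale_right_distrib scale_sum_right mult.commute add.assoc)
  also have "(\<Sum>i<n. scale (b i ^ CHAR('k)) (f (Suc i))) + \<dots>
      = scale (b n ^ CHAR('k)) z + (scale (b 0) (f 0) + (\<Sum>i<n. scale (b (Suc i)) (f (Suc i))))"
    by (simp add: b0 bS scale_left_distrib sum.distrib algebra_simps)
  also have "scale (b 0) (f 0) + (\<Sum>i<n. scale (b (Suc i)) (f (Suc i))) = y"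
    unfolding y_def n by (simp only: sum.lessThan_Suc_shift)
  finally have py: "pmap y = scale (b n ^ CHAR('k)) z + y" .

  \<comment> \<open>Surjectivity of \<open>pmap - 1\<close> on the toral span.\<close>
  have AS: "\<exists>w\<in>span H. pmap w - w = v" if "v \<in> span H" for v
    using that
  proof (induction rule: span_induct_alt)
    case base
    show ?case using pmap_zero by (intro bexI[of _ 0]) (auto simp: span_zero)
  next
    case (step c h v)
    then obtain w where w: "w \<in> span H" "pmap w - w = v" by blast
    obtain d where d: "d ^ CHAR('k) - d = c" using artin_schreier_root[OF char_gt_1] by blast
    have h: "scale d h \<in> span H" using step by (intro span_scale span_base)
    have "pmap (scale d h + w) = scale (d ^ CHAR('k)) h + pmap w"
      using commutingD[OF commuting_span[OF cH] h w(1)] step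
      by (simp add: pmap_add_commuting pmap_scale H_def toral_def)
    then have "pmap (scale d h + w) - (scale d h + w) = scale c h + v"
      by (simp add: d[symmetric] w(2)[symmetric] scale_left_diff_distrib)
    then show ?case using h w(1) by (intro bexI[of _ "scale d h + w"]) (auto intro: span_add)
  qed
  obtain w where w: "w \<in> span H" "pmap w - w = - scale (b n ^ CHAR('k)) z"
    using AS[of "- scale (b n ^ CHAR('k)) z"] a by (auto simp: z_def span_neg span_scale)
  have wT: "w \<in> T" using w spH by blast
  have "pmap (y + w) = y + w"
    using w(2) by (simp add: pmap_add_commuting commutingD[OF cT yT wT] py diff_eq_eq)
  then have "y + w \<in> H" using yT wT sT by (simp add: H_def toral_def subspace_add)
  then have "(y + w) - w \<in> span H" using w by (intro span_diff) (auto intro: span_base)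
  then show False using yH by simp
qed

end

section \<open>Polynomial functions on the variety of embeddings\<close>

lemma generated_algebra_sum:
  assumes "finite I" "\<And>i. i \<in> I \<Longrightarrow> F i \<in> generated_algebra L"
  shows "(\<lambda>v. \<Sum>i\<in>I. F i v) \<in> generated_algebra L"
  using assms
  by (induction I rule: finite_induct) (auto intro: generated_algebra.intros)

lemma generated_algebra_power:
  assumes "F \<in> generated_algebra L"
  shows "(\<lambda>v. F v ^ n) \<in> generated_algebra L"
  using assms by (induction n) (auto intro: generated_algebra.intros)

lemma generated_algebra_diff:
  assumes "F \<in> generated_algebra L" "G \<in> generated_algebra L"
  shows "(\<lambda>v. F v - G v) \<in> generated_algebra L"
proof -
  have "(\<lambda>v. F v + (- 1) * G v) \<in> generated_algebra L"
    by (intro generated_algebra.add assms(1) generated_algebra.mult[OF generated_algebra.const assms(2)])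
  then show ?thesis by simp
qed

context restricted_lie_algebra
begin

text \<open>Irreducibility in the form in which it is used: two nonempty basic open subsets meet.\<close>

lemma irreducible_common_nonzero:
  assumes irr: "irreducible_space (torus_variety T)"
    and P: "P \<in> generated_algebra (matrix_coeffs T)" and Q: "Q \<in> generated_algebra (matrix_coeffs T)"
    and f: "f \<in> torus_embeddings T" "P f \<noteq> 0" and g: "g \<in> torus_embeddings T" "Q g \<noteq> 0"
  shows "\<exists>h\<in>torus_embeddings T. P h \<noteq> 0 \<and> Q h \<noteq> 0"
proof (rule ccontr)
  assume no: "\<not> ?thesis"
  have sub: "torus_embeddings T \<subseteq> Hom_k T" by (auto simp: torus_embeddings_def)
  have top: "topspace (torus_variety T) = torus_embeddings T"
    using sub by (auto simp: torus_variety_def)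
  have closed: "closedin (torus_variety T) {h \<in> torus_embeddings T. R h = 0}"
    if "R \<in> generated_algebra (matrix_coeffs T)" for R
    unfolding torus_variety_def closedin_subtopology closedin_zariski
    by (rule exI[of _ "zero_locus (Hom_k T) {R}"])
      (use that sub in \<open>auto simp: zero_locus_def intro!: exI[of _ "{R}"]\<close>)
  have "{h \<in> torus_embeddings T. P h = 0} \<union> {h \<in> torus_embeddings T. Q h = 0}
      = topspace (torus_variety T)"
    using no by (auto simp: top)
  then have "{h \<in> torus_embeddings T. P h = 0} = torus_embeddings T
      \<or> {h \<in> torus_embeddings T. Q h = 0} = torus_embeddings T"
    using irr closed[OF P] closed[OF Q] unfolding irreducible_space_def by (simp add: top)
  then show False using f g by blast
qed

end

text \<open>A family and not a set of vectors, because members that depend on a parameter may coincide for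
special values of the parameter.\<close>

definition (in vector_space) independent_family :: "'i set \<Rightarrow> ('i \<Rightarrow> 'b) \<Rightarrow> bool"
  where "independent_family I v \<longleftrightarrow> (\<forall>c. (\<Sum>i\<in>I. scale (c i) (v i)) = 0 \<longrightarrow> (\<forall>i\<in>I. c i = 0))"

lemma (in vector_space) independent_familyD:
  "independent_family I v \<Longrightarrow> (\<Sum>i\<in>I. scale (c i) (v i)) = 0 \<Longrightarrow> i \<in> I \<Longrightarrow> c i = 0"
  by (simp add: independent_family_def)

lemma (in vector_space) independent_family_inj_on:
  assumes "finite I" "independent_family I v"
  shows "inj_on v I"
proof (rule inj_onI)
  fix i j assume ij: "i \<in> I" "j \<in> I" "v i = v j"
  show "i = j"
  proof (rule ccontr)
    assume "i \<noteq> j"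
    let ?c = "\<lambda>l. (if l = i then 1 else 0) - (if l = j then 1 else 0) :: 'a"
    have "(\<Sum>l\<in>I. scale (?c l) (v l)) = v i - v j"
      using assms(1) ij
      by (simp add: scale_left_diff_distrib sum_subtractf if_distrib[of "\<lambda>c. scale c _"] cong: if_cong)
    then have "?c i = 0" using independent_familyD[OF assms(2), of ?c i] ij by simp
    then show False using \<open>i \<noteq> j\<close> by simp
  qed
qed

lemma (in vector_space) independent_family_image:
  assumes "finite I" "independent_family I v"
  shows "independent (v ` I)"
proof (rule independent_if_scalars_zero)
  show "finite (v ` I)" using assms(1) by simp
next
  fix c x assume "(\<Sum>x\<in>v ` I. scale (c x) x) = 0" "x \<in> v ` I"
  moreover have "(\<Sum>x\<in>v ` I. scale (c x) x) = (\<Sum>i\<in>I. scale (c (v i)) (v i))"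
    using independent_family_inj_on[OF assms] by (rule sum.reindex_cong) auto
  ultimately show "c x = 0" using assms(2) unfolding independent_family_def by auto
qed

context alg_closed_restricted_lie_algebra
begin

lemma vector_space_mult: "vector_space ((*) :: 'k \<Rightarrow> 'k \<Rightarrow> 'k)"
  by unfold_locales (simp_all add: algebra_simps)

sublocale functionals: vector_space_pair scale "(*) :: 'k \<Rightarrow> 'k \<Rightarrow> 'k"
  by (intro vector_space_pair.intro vector_space_mult) unfold_locales

lemma exists_linear_form:
  assumes "y \<noteq> 0"
  shows "\<exists>\<xi>. Vector_Spaces.linear scale (*) \<xi> \<and> \<xi> y \<noteq> 0"
proof -
  have "independent {y}" using assms by simp
  then obtain \<xi> where "Vector_Spaces.linear scale (*) \<xi>" "\<xi> y = 1"
    using functionals.linear_independent_extend[of "{y}" "\<lambda>_. 1"] by auto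
  then show ?thesis by (metis zero_neq_one)
qed

text \<open>The vector-valued polynomial functions of an embedding, described without coordinates by composing
with all linear forms.\<close>

definition regular :: "'g set \<Rightarrow> (('g \<Rightarrow> 'g) \<Rightarrow> 'g) \<Rightarrow> bool"
  where "regular T v \<longleftrightarrow>
    (\<forall>\<xi>. Vector_Spaces.linear scale (*) \<xi> \<longrightarrow> (\<lambda>f. \<xi> (v f)) \<in> generated_algebra (matrix_coeffs T))"

lemma regularD:
  "regular T v \<Longrightarrow> Vector_Spaces.linear scale (*) \<xi> \<Longrightarrow> (\<lambda>f. \<xi> (v f)) \<in> generated_algebra (matrix_coeffs T)"
  by (simp add: regular_def)

lemma regular_const: "regular T (\<lambda>_. x)"
  by (simp add: regular_def generated_algebra.const)

lemma regular_scale: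
  assumes "P \<in> generated_algebra (matrix_coeffs T)" "regular T v"
  shows "regular T (\<lambda>f. scale (P f) (v f))"
  unfolding regular_def
proof (intro allI impI)
  fix \<xi> assume "Vector_Spaces.linear scale (*) \<xi>"
  then show "(\<lambda>f. \<xi> (scale (P f) (v f))) \<in> generated_algebra (matrix_coeffs T)"
    using assms by (simp add: functionals.linear_scale generated_algebra.mult regularD)
qed

lemma regular_diff:
  assumes "regular T v" "regular T w"
  shows "regular T (\<lambda>f. v f - w f)"
  unfolding regular_def
proof (intro allI impI)
  fix \<xi> assume "Vector_Spaces.linear scale (*) \<xi>"
  then show "(\<lambda>f. \<xi> (v f - w f)) \<in> generated_algebra (matrix_coeffs T)"
    using assms by (simp add: functionals.linear_diff generated_algebra_diff regularD)
qed

lemma regular_sum: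
  assumes "finite I" "\<And>i. i \<in> I \<Longrightarrow> regular T (v i)"
  shows "regular T (\<lambda>f. \<Sum>i\<in>I. v i f)"
  unfolding regular_def
proof (intro allI impI)
  fix \<xi> assume "Vector_Spaces.linear scale (*) \<xi>"
  then show "(\<lambda>f. \<xi> (\<Sum>i\<in>I. v i f)) \<in> generated_algebra (matrix_coeffs T)"
    using assms by (simp add: functionals.linear_sum generated_algebra_sum regularD)
qed

text \<open>Expanding \<open>v(f)\<close> in a basis turns \<open>\<xi>([f t, v(f)])\<close> into a sum of products of a coordinate of \<open>v(f)\<close>
with a linear form in \<open>f t\<close>.\<close>

lemma regular_bracket:
  assumes "t \<in> T" "regular T v"
  shows "regular T (\<lambda>f. bracket (f t) (v f))"
  unfolding regular_def
proof (intro allI impI)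
  fix \<xi> assume \<xi>: "Vector_Spaces.linear scale (*) \<xi>"
  define c where "c e x = representation Basis x e" for e x
  have c: "Vector_Spaces.linear scale (*) (c e)" for e
    unfolding c_def by (rule linear_representation[OF independent_Basis span_Basis])
  have expand: "\<xi> (bracket y x) = (\<Sum>e\<in>Basis. c e x * \<xi> (bracket y e))" for x y
  proof -
    have "x = (\<Sum>e\<in>Basis. scale (c e x) e)"
      unfolding c_def using independent_Basis finite_Basis
      by (intro sum_representation_eq[symmetric]) (auto simp: span_Basis)
    then have "\<xi> (bracket y x) = \<xi> (bracket y (\<Sum>e\<in>Basis. scale (c e x) e))" by simp
    also have "\<dots> = (\<Sum>e\<in>Basis. c e x * \<xi> (bracket y e))"
      using \<xi> by (simp add: ad.sum ad.scale functionals.linear_sum functionals.linear_scale)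
    finally show ?thesis .
  qed
  have coeff: "(\<lambda>f. \<xi> (bracket (f t) e)) \<in> generated_algebra (matrix_coeffs T)" for e
  proof -
    have "Vector_Spaces.linear scale (*) (\<lambda>y. \<xi> (bracket y e))"
      using Vector_Spaces.linear_compose[OF bracket_linear_left \<xi>] by (simp add: o_def)
    then show ?thesis
      using assms(1) by (intro generated_algebra.gen) (auto simp: matrix_coeffs_def)
  qed
  have "(\<lambda>f. \<Sum>e\<in>Basis. c e (v f) * \<xi> (bracket (f t) e)) \<in> generated_algebra (matrix_coeffs T)"
    by (intro generated_algebra_sum[OF finite_Basis]
        generated_algebra.mult[OF regularD[OF assms(2) c] coeff])
  then show "(\<lambda>f. \<xi> (bracket (f t) (v f))) \<in> generated_algebra (matrix_coeffs T)"
    by (subst expand)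
qed

lemma regular_eigenproj:
  assumes "t \<in> T" "regular T v"
  shows "regular T (\<lambda>f. eigenproj (f t) s (v f))"
proof -
  have "regular T (\<lambda>f. (bracket (f t) ^^ i) (v f))" for i
    by (induction i) (simp_all add: assms regular_bracket)
  then show ?thesis
    unfolding eigenproj_def using assms(2)
    by (intro regular_diff regular_sum regular_scale generated_algebra.const)
       (cases "s = 0"; simp add: regular_const)+
qed

text \<open>Gaussian elimination with polynomial coefficients. Choose a linear form \<open>\<xi>\<close> with \<open>\<xi>(v\<^sub>j(f\<^sub>0)) \<noteq> 0\<close> and
replace each other \<open>v\<^sub>i\<close> by \<open>w\<^sub>i = \<xi>(v\<^sub>j) v\<^sub>i - \<xi>(v\<^sub>i) v\<^sub>j\<close>. As long as the pivot \<open>\<xi>(v\<^sub>j(f))\<close> is nonzero,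
the family \<open>v(f)\<close> is independent if \<open>w(f)\<close> is. The wanted polynomial is the product of all pivots.\<close>

lemma independent_family_open:
  assumes "finite I" "\<And>i. i \<in> I \<Longrightarrow> regular T (v i)" "independent_family I (\<lambda>i. v i f0)"
  shows "\<exists>P\<in>generated_algebra (matrix_coeffs T). P f0 \<noteq> 0 \<and>
    (\<forall>f. P f \<noteq> 0 \<longrightarrow> independent_family I (\<lambda>i. v i f))"
  using assms
proof (induction I arbitrary: v rule: finite_induct)
  case empty
  show ?case
    by (intro bexI[of _ "\<lambda>_. 1"]) (auto simp: independent_family_def intro: generated_algebra.const)
next
  case (insert j I)
  have ind: "\<forall>i\<in>insert j I. c i = 0" if "(\<Sum>i\<in>insert j I. scale (c i) (v i f0)) = 0" for c
    using insert.prems(2) that unfolding independent_family_def by blast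
  have "v j f0 \<noteq> 0"
  proof
    assume "v j f0 = 0"
    then have "(\<Sum>i\<in>insert j I. scale ((if i = j then 1 else 0)) (v i f0)) = 0"
      using insert.hyps by (intro sum.neutral) auto
    from ind[OF this] show False by auto
  qed
  then obtain \<xi> where \<xi>: "Vector_Spaces.linear scale (*) \<xi>" "\<xi> (v j f0) \<noteq> 0"
    using exists_linear_form by blast
  \<comment> \<open>One elimination step with pivot \<open>\<xi> (v j f)\<close>.\<close>
  define w where "w i f = scale (\<xi> (v j f)) (v i f) - scale (\<xi> (v i f)) (v j f)" for i f
  \<comment> \<open>A linear combination of the \<open>w i\<close> as one of the \<open>v i\<close>; it transports independence both ways.\<close>
  have wsum: "(\<Sum>i\<in>I. scale (c i) (w i f))
      = (\<Sum>i\<in>insert j I. scale (if i = j then - (\<Sum>i\<in>I. c i * \<xi> (v i f)) else c i * \<xi> (v j f)) (v i f))"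
    for c f
  proof -
    have "(\<Sum>i\<in>I. scale (if i = j then x else c i * \<xi> (v j f)) (v i f))
        = (\<Sum>i\<in>I. scale (c i * \<xi> (v j f)) (v i f))" for x
      using insert.hyps by (intro sum.cong) auto
    then show ?thesis using insert.hyps
      by (simp add: w_def scale_right_diff_distrib sum_subtractf scale_sum_left)
  qed
  have "independent_family I (\<lambda>i. w i f0)"
    unfolding independent_family_def
  proof (intro allI impI ballI)
    fix c i assume "(\<Sum>i\<in>I. scale (c i) (w i f0)) = 0" and i: "i \<in> I"
    from ind[OF this(1)[unfolded wsum], THEN bspec[of _ _ i]] i insert.hyps \<xi>(2)
    show "c i = 0" by (auto split: if_splits)
  qed
  moreover have "regular T (w i)" if "i \<in> I" for i
    unfolding w_def using insert.prems(1) that \<xi>(1)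
    by (intro regular_diff regular_scale regularD[OF _ \<xi>(1)]) auto
  ultimately obtain P where P: "P \<in> generated_algebra (matrix_coeffs T)" "P f0 \<noteq> 0"
    and PI: "\<And>f. P f \<noteq> 0 \<Longrightarrow> independent_family I (\<lambda>i. w i f)"
    using insert.IH[of w] by blast
  have "independent_family (insert j I) (\<lambda>i. v i f)" if f: "P f \<noteq> 0" "\<xi> (v j f) \<noteq> 0" for f
    unfolding independent_family_def
  proof (intro allI impI)
    fix c assume c: "(\<Sum>i\<in>insert j I. scale (c i) (v i f)) = 0"
    have vj: "v j f \<noteq> 0" using f(2) functionals.linear_0[OF \<xi>(1)] by auto
    have "\<xi> (\<Sum>i\<in>insert j I. scale (c i) (v i f)) = 0" using c functionals.linear_0[OF \<xi>(1)] by simp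
    then have "c j * \<xi> (v j f) + (\<Sum>i\<in>I. c i * \<xi> (v i f)) = 0"
      using insert.hyps \<xi>(1) by (simp add: functionals.linear_add functionals.linear_sum functionals.linear_scale)
    then have cj: "- (\<Sum>i\<in>I. c i * \<xi> (v i f)) = \<xi> (v j f) * c j"
      by (simp add: neg_eq_iff_add_eq_0 add.commute mult.commute)
    have "(\<Sum>i\<in>I. scale (c i) (w i f)) = (\<Sum>i\<in>insert j I. scale (\<xi> (v j f)) (scale (c i) (v i f)))"
      unfolding wsum by (rule sum.cong) (auto simp: cj mult.commute)
    also have "\<dots> = 0" using c by (simp only: scale_sum_right[symmetric] scale_zero_right)
    finally have cI: "\<forall>i\<in>I. c i = 0" using PI[OF f(1)] unfolding independent_family_def by blast
    then have "(\<Sum>i\<in>I. scale (c i) (v i f)) = 0" by (intro sum.neutral) auto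
    then have "scale (c j) (v j f) = 0" using c insert.hyps by simp
    then show "\<forall>i\<in>insert j I. c i = 0" using cI vj by auto
  qed
  moreover have "(\<lambda>f. P f * \<xi> (v j f)) \<in> generated_algebra (matrix_coeffs T)"
    using P(1) insert.prems(1) \<xi>(1) by (intro generated_algebra.mult regularD) auto
  ultimately show ?case
    using P(2) \<xi>(2) by (intro bexI[of _ "\<lambda>f. P f * \<xi> (v j f)"]) auto
qed

section \<open>Weight spaces of an embedded torus\<close>

text \<open>The root spaces of the torus \<open>f(T)\<close>, but indexed by linear forms on the fixed torus \<open>T\<close>, so
that they can be compared for different \<open>f\<close>.\<close>

definition weight_space :: "'g set \<Rightarrow> ('g \<Rightarrow> 'g) \<Rightarrow> ('g \<Rightarrow> 'k) \<Rightarrow> 'g set"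
  where "weight_space T f a = {x. \<forall>t\<in>T. bracket (f t) x = scale (a t) x}"

lemma root_space_eq_weight_space:
  assumes "\<And>t. t \<in> T \<Longrightarrow> f t = t"
  shows "root_space T a = weight_space T f a"
  using assms by (auto simp: root_space_def weight_space_def)

lemma torus_subspace: "torus T \<Longrightarrow> subspace T"
  and torus_pmap: "torus T \<Longrightarrow> x \<in> T \<Longrightarrow> pmap x \<in> T"
  and torus_commuting: "torus T \<Longrightarrow> commuting T"
  by (auto simp: torus_def p_subalgebra_def commuting_def)

lemma torus_toral_basis:
  assumes "torus T"
  obtains H where "finite H" "independent H" "H \<subseteq> T" "\<And>h. h \<in> H \<Longrightarrow> toral h" "T = span H"
proof -
  obtain H where H: "H \<subseteq> {h\<in>T. toral h}" "independent H" "{h\<in>T. toral h} \<subseteq> span H"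
    using maximal_independent_subset by blast
  have "span H = span {h\<in>T. toral h}"
    using H by (metis span_mono span_span subset_antisym)
  then have "T = span H" using torus_eq_span_toral[OF assms] by simp
  then show ?thesis using H by (intro that[of H]) (auto intro: finiteI_independent)
qed

lemma Hom_kD:
  assumes "f \<in> Hom_k T" "x \<in> T"
  shows "f (scale c x) = scale c (f x)" "y \<in> T \<Longrightarrow> f (x + y) = f x + f y"
  using assms by (auto simp: Hom_k_def linear_on_def)

lemma Hom_k_zero: "f \<in> Hom_k T \<Longrightarrow> subspace T \<Longrightarrow> f 0 = 0"
  using Hom_kD(1)[of f T 0 0] by (simp add: subspace_0)

lemma dual_spaceD:
  assumes "a \<in> dual_space T" "x \<in> T"
  shows "a (scale c x) = c * a x" "y \<in> T \<Longrightarrow> a (x + y) = a x + a y"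
  using assms by (auto simp: dual_space_def linear_on_def)

lemma dual_space_zero: "a \<in> dual_space T \<Longrightarrow> subspace T \<Longrightarrow> a 0 = 0"
  using dual_spaceD(1)[of a T 0 0] by (simp add: subspace_0)

lemma embeddingD:
  assumes "f \<in> torus_embeddings T"
  shows "f \<in> Hom_k T" "inj_on f T"
    "x \<in> T \<Longrightarrow> f (pmap x) = pmap (f x)"
    "x \<in> T \<Longrightarrow> y \<in> T \<Longrightarrow> f (bracket x y) = bracket (f x) (f y)"
  using assms by (auto simp: torus_embeddings_def)

lemma embedding_commuting:
  assumes "torus T" "f \<in> torus_embeddings T" "x \<in> T" "y \<in> T"
  shows "bracket (f x) (f y) = 0"
  using assms embeddingD(4)[OF assms(2-4)] Hom_k_zero[OF embeddingD(1)[OF assms(2)] torus_subspace[OF assms(1)]]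
    commutingD[OF torus_commuting[OF assms(1)] assms(3,4)] by simp

lemma embedding_toral: "f \<in> torus_embeddings T \<Longrightarrow> h \<in> T \<Longrightarrow> toral h \<Longrightarrow> toral (f h)"
  using embeddingD(3)[of f T h] by (simp add: toral_def)

lemma weight_spaceI_span:
  assumes T: "subspace T" "T = span H" "H \<subseteq> T" and f: "f \<in> Hom_k T" and a: "a \<in> dual_space T"
    and x: "\<And>h. h \<in> H \<Longrightarrow> bracket (f h) x = scale (a h) x"
  shows "x \<in> weight_space T f a"
proof -
  have "t \<in> T \<and> bracket (f t) x = scale (a t) x" if "t \<in> span H" for t
    using that
  proof (induction rule: span_induct_alt)
    case base
    show ?case using Hom_k_zero[OF f T(1)] dual_space_zero[OF a T(1)] subspace_0[OF T(1)]
      by (simp add: bracket_left.zero)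
  next
    case (step c h y)
    have "h \<in> T" "scale c h \<in> T" using step(1) T(1,3) by (auto intro: subspace_scale)
    then show ?case using step x[OF step(1)]
      by (simp add: Hom_kD[OF f] dual_spaceD[OF a] bracket_left.add bracket_left.scale scale_left_distrib
          subspace_add[OF T(1)])
  qed
  then show ?thesis using T(2) by (simp add: weight_space_def)
qed

text \<open>On a common eigenvector \<open>ad (t\<^bsup>[p]\<^esup>) = (ad t)\<^bsup>p\<^esup>\<close> has the eigenvalue \<open>a(t)\<^bsup>p\<^esup>\<close>.\<close>

lemma weight_in_Lie_p:
  assumes "\<And>t. t \<in> T \<Longrightarrow> pmap t \<in> T" "\<And>t. t \<in> T \<Longrightarrow> f (pmap t) = pmap (f t)"
    and a: "a \<in> dual_space T" and x: "x \<noteq> 0" "x \<in> weight_space T f a"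
  shows "a \<in> Lie_p T"
proof -
  have "a (pmap t) = a t ^ CHAR('k)" if t: "t \<in> T" for t
  proof -
    have "bracket (f t) x = scale (a t) x" using x(2) t by (simp add: weight_space_def)
    then have "(bracket (f t) ^^ n) x = scale (a t ^ n) x" for n
      by (induction n) (simp_all add: ad.scale mult.commute)
    then have "bracket (f (pmap t)) x = scale (a t ^ CHAR('k)) x"
      using assms(2)[OF t] by (simp add: pmap_ad)
    moreover have "bracket (f (pmap t)) x = scale (a (pmap t)) x"
      using x(2) assms(1)[OF t] by (simp add: weight_space_def)
    ultimately show ?thesis using x(1) by simp
  qed
  then show ?thesis using a by (simp add: Lie_p_def)
qed

lemma simultaneous_eigenvector_weight:
  assumes T: "subspace T" "T = span H" "H \<subseteq> T" and f: "f \<in> Hom_k T"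
    and x: "x \<noteq> 0" "\<And>h. h \<in> H \<Longrightarrow> \<exists>s. bracket (f h) x = scale s x"
  shows "\<exists>a\<in>dual_space T. x \<in> weight_space T f a"
proof -
  have "t \<in> T \<and> (\<exists>s. bracket (f t) x = scale s x)" if "t \<in> span H" for t
    using that
  proof (induction rule: span_induct_alt)
    case base
    show ?case using Hom_k_zero[OF f T(1)] subspace_0[OF T(1)]
      by (intro conjI exI[of _ 0]) (simp_all add: bracket_left.zero)
  next
    case (step c h y)
    have "h \<in> T" "scale c h \<in> T" using step(1) T(1,3) by (auto intro: subspace_scale)
    moreover have "y \<in> T" using step by blast
    moreover obtain s r where "bracket (f h) x = scale s x" "bracket (f y) x = scale r x"
      using x(2)[OF step(1)] step by blast
    ultimately show ?case
      by (intro conjI exI[of _ "c * s + r"])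
        (simp_all add: Hom_kD[OF f] bracket_left.add bracket_left.scale scale_left_distrib subspace_add[OF T(1)])
  qed
  then obtain a where a: "\<And>t. t \<in> T \<Longrightarrow> bracket (f t) x = scale (a t) x"
    using T(2) by metis
  have "restrict a T \<in> dual_space T"
  proof -
    have "a (s + t) = a s + a t" if st: "s \<in> T" "t \<in> T" for s t
    proof -
      have "scale (a (s + t)) x = scale (a s + a t) x"
        using st a subspace_add[OF T(1) st]
        by (metis Hom_kD(2)[OF f] bracket_left.add scale_left_distrib)
      then show ?thesis using x(1) by simp
    qed
    moreover have "a (scale c t) = c * a t" if t: "t \<in> T" for c t
    proof -
      have "scale (a (scale c t)) x = scale (c * a t) x"
        using t a subspace_scale[OF T(1) t]
        by (metis Hom_kD(1)[OF f] bracket_left.scale scale_scale)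
      then show ?thesis using x(1) by simp
    qed
    ultimately show ?thesis
      using T(1) by (auto simp: dual_space_def linear_on_def subspace_add subspace_scale)
  qed
  moreover have "x \<in> weight_space T f (restrict a T)" using a by (simp add: weight_space_def)
  ultimately show ?thesis by blast
qed

text \<open>Weight vectors are the simultaneous eigenvectors of the images of finitely many toral elements
spanning \<open>T\<close>.\<close>

lemma weight_spaces_span:
  assumes T: "torus T" and f: "f \<in> torus_embeddings T"
  shows "span (\<Union>a\<in>Lie_p T. weight_space T f a) = UNIV"
proof -
  obtain H where H: "finite H" "independent H" "H \<subseteq> T" "\<And>h. h \<in> H \<Longrightarrow> toral h" "T = span H"
    using torus_toral_basis[OF T] by blast
  define E where "E = {y. \<forall>h\<in>f ` H. \<exists>s. s ^ CHAR('k) = s \<and> bracket h y = scale s y}"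
  have E: "span E = UNIV"
    unfolding E_def by (rule simultaneous_eigenvectors_span)
      (use H embedding_toral[OF f] embedding_commuting[OF T f] in \<open>auto simp: subset_iff\<close>)
  have "E \<subseteq> span (\<Union>a\<in>Lie_p T. weight_space T f a)"
  proof
    fix y assume y: "y \<in> E"
    show "y \<in> span (\<Union>a\<in>Lie_p T. weight_space T f a)"
    proof (cases "y = 0")
      case False
      obtain a where "a \<in> dual_space T" "y \<in> weight_space T f a"
        using simultaneous_eigenvector_weight[OF torus_subspace[OF T] H(5,3) embeddingD(1)[OF f] False] y
        unfolding E_def by blast
      moreover from this have "a \<in> Lie_p T"
        using torus_pmap[OF T] embeddingD(3)[OF f] False by (intro weight_in_Lie_p[of T f a y])
      ultimately show ?thesis by (intro span_base) blast
    qed (simp add: span_zero)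
  qed
  from span_minimal[OF this subspace_span] show ?thesis
    unfolding E by (rule top.extremum_uniqueI)
qed

text \<open>In a basis of weight vectors, a vector of weight \<open>a\<close> involves only basis vectors of weight \<open>a\<close>,
because two distinct weights differ at some \<open>t\<close> and the eigenvalues of \<open>ad (f t)\<close> then force the
coefficients to vanish.\<close>

lemma dim_weight_space:
  assumes fin: "finite B" and ind: "independent_family B v" and card: "card B = dimension"
    and v: "\<And>b. b \<in> B \<Longrightarrow> v b \<in> weight_space T f (w b)"
    and w: "\<And>b. b \<in> B \<Longrightarrow> w b \<in> extensional T" and a: "a \<in> extensional T"
  shows "dim (weight_space T f a) = card {b\<in>B. w b = a}"
proof -
  note inj = independent_family_inj_on[OF fin ind]
  note indep = independent_family_image[OF fin ind]
  have "card (v ` B) = dimension" using inj card by (simp add: card_image)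
  then have span: "span (v ` B) = UNIV"
    using card_ge_dim_independent[OF subset_UNIV indep] by (auto simp: dimension_def)
  define C where "C = {b\<in>B. w b = a}"
  have "weight_space T f a \<subseteq> span (v ` C)"
  proof
    fix x assume x: "x \<in> weight_space T f a"
    have "x \<in> span (v ` B)" using span by simp
    then obtain u where "x = (\<Sum>y\<in>v ` B. scale (u y) y)"
      using fin by (auto simp: span_finite)
    then have xu: "x = (\<Sum>b\<in>B. scale (u (v b)) (v b))"
      using inj by (simp add: sum.reindex o_def)
    have "u (v b) = 0" if b: "b \<in> B" "w b \<noteq> a" for b
    proof -
      obtain t where t: "t \<in> T" "w b t \<noteq> a t"
        using b a w[OF b(1)] by (meson extensionalityI)
      have "bracket (f t) x = (\<Sum>b\<in>B. scale (u (v b) * w b t) (v b))"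
        using v t(1) by (subst xu) (simp add: ad.sum ad.scale weight_space_def)
      moreover have "bracket (f t) x = (\<Sum>b\<in>B. scale (u (v b) * a t) (v b))"
        using x t(1) by (simp add: weight_space_def) (subst xu, simp add: scale_sum_right mult.commute)
      ultimately have "(\<Sum>b\<in>B. scale (u (v b) * (w b t - a t)) (v b)) = 0"
        by (simp add: right_diff_distrib scale_left_diff_distrib sum_subtractf)
      then have "u (v b) * (w b t - a t) = 0"
        using independent_familyD[OF ind, of "\<lambda>b. u (v b) * (w b t - a t)"] b(1) by simp
      then show ?thesis using t(2) by simp
    qed
    then have "x = (\<Sum>b\<in>C. scale (u (v b)) (v b))"
      unfolding xu C_def using fin by (intro sum.mono_neutral_right) auto
    then show "x \<in> span (v ` C)"
      by (auto intro!: span_sum span_scale intro: span_base)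
  qed
  moreover have "v ` C \<subseteq> weight_space T f a" using v by (auto simp: C_def)
  moreover have "independent (v ` C)" using indep by (rule independent_mono) (auto simp: C_def)
  ultimately have "dim (weight_space T f a) = card (v ` C)"
    by (intro basis_card_eq_dim[symmetric])
  also have "\<dots> = card C" using inj by (intro card_image) (auto simp: C_def inj_on_def)
  finally show ?thesis by (simp add: C_def)
qed

text \<open>Each projection maps into its own eigenspace and, since the adjoint operators commute, preserves the
eigenspaces of the other elements.\<close>

lemma weight_projection:
  assumes f: "\<And>h h'. h \<in> set hs \<Longrightarrow> h' \<in> set hs \<Longrightarrow> bracket (f h) (f h') = 0"
    "\<And>h. h \<in> set hs \<Longrightarrow> toral (f h)" and s: "\<And>h. h \<in> set hs \<Longrightarrow> s h ^ CHAR('k) = s h"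
    and h: "h \<in> set hs"
  shows "bracket (f h) (foldr (\<lambda>h. eigenproj (f h) (s h)) hs x)
    = scale (s h) (foldr (\<lambda>h. eigenproj (f h) (s h)) hs x)"
  using assms
proof (induction hs)
  case (Cons g hs)
  show ?case
  proof (cases "h = g")
    case True
    then show ?thesis using Cons.prems by (simp add: bracket_eigenproj)
  next
    case False
    then have "h \<in> set hs" "bracket (f h) (f g) = 0" using Cons.prems by auto
    then show ?thesis using Cons by (simp add: eigenproj_commute eigenproj_scale)
  qed
qed simp

text \<open>Take a basis of weight vectors for \<open>f\<^sub>0\<close> and apply to each of them the projection onto the weight
space for \<open>f\<close> of the same weight. For \<open>f = f\<^sub>0\<close> this changes nothing, and the projected vectors
are polynomials in \<open>f\<close>; so they form a basis of weight vectors for all \<open>f\<close> in an open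
neighbourhood of \<open>f\<^sub>0\<close>, with the same number of vectors of each weight.\<close>

lemma dim_weight_space_locally_constant:
  assumes T: "torus T" and f0: "f0 \<in> torus_embeddings T"
  shows "\<exists>P\<in>generated_algebra (matrix_coeffs T). P f0 \<noteq> 0 \<and>
    (\<forall>f\<in>torus_embeddings T. P f \<noteq> 0 \<longrightarrow>
      (\<forall>a\<in>Lie_p T. dim (weight_space T f a) = dim (weight_space T f0 a)))"
proof -
  obtain H where H: "finite H" "independent H" "H \<subseteq> T" "\<And>h. h \<in> H \<Longrightarrow> toral h" "T = span H"
    using torus_toral_basis[OF T] by blast
  obtain hs where hs: "set hs = H" using finite_list[OF H(1)] by blast
  obtain B where B: "B \<subseteq> (\<Union>a\<in>Lie_p T. weight_space T f0 a)" "independent B"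
    "(\<Union>a\<in>Lie_p T. weight_space T f0 a) \<subseteq> span B"
    using maximal_independent_subset by blast
  have finB: "finite B" using B(2) by (rule finiteI_independent)
  have "span B = UNIV"
    using span_minimal[OF B(3) subspace_span] weight_spaces_span[OF T f0] by auto
  then have card: "card B = dimension"
    using basis_card_eq_dim[of B UNIV] B(2) by (simp add: dimension_def)
  have "\<forall>b\<in>B. \<exists>a. a \<in> Lie_p T \<and> b \<in> weight_space T f0 a" using B(1) by blast
  then obtain w where w: "\<And>b. b \<in> B \<Longrightarrow> w b \<in> Lie_p T" "\<And>b. b \<in> B \<Longrightarrow> b \<in> weight_space T f0 (w b)"
    by metis
  have wd: "w b \<in> dual_space T" "w b \<in> extensional T" if "b \<in> B" for b
    using w(1)[OF that] by (auto simp: Lie_p_def dual_space_def)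
  have wp: "w b h ^ CHAR('k) = w b h" if "b \<in> B" "h \<in> H" for b h
    using w(1)[OF that(1)] H(3) H(4)[OF that(2)] that(2) by (force simp: Lie_p_def toral_def)
  \<comment> \<open>The basis vector \<open>b\<close> of weight \<open>w b\<close> projected to the weight space of weight \<open>w b\<close> for \<open>f\<close>.\<close>
  define v where "v b f = foldr (\<lambda>h. eigenproj (f h) (w b h)) hs b" for b f
  have v0: "v b f0 = b" if b: "b \<in> B" for b
  proof -
    have "bracket (f0 h) b = scale (w b h) b" if "h \<in> H" for h
      using w(2)[OF b] H(3) that by (auto simp: weight_space_def)
    then have "foldr (\<lambda>h. eigenproj (f0 h) (w b h)) gs b = b" if "set gs \<subseteq> H" for gs
      using that wp[OF b] by (induction gs) (simp_all add: eigenproj_eigenvector)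
    then show ?thesis using hs by (simp add: v_def)
  qed
  have "independent_family B (\<lambda>b. v b f0)"
    unfolding independent_family_def
  proof (intro allI impI ballI)
    fix c b assume "(\<Sum>b\<in>B. scale (c b) (v b f0)) = 0" and b: "b \<in> B"
    moreover have "(\<Sum>b\<in>B. scale (c b) (v b f0)) = (\<Sum>b\<in>B. scale (c b) b)"
      by (rule sum.cong) (simp_all add: v0)
    ultimately show "c b = 0" using independentD[OF B(2) finB subset_refl] by metis
  qed
  moreover have "regular T (v b)" for b
  proof -
    have "regular T (\<lambda>f. foldr (\<lambda>h. eigenproj (f h) (w b h)) gs b)" if "set gs \<subseteq> T" for gs
      using that by (induction gs) (simp_all add: regular_const regular_eigenproj)
    then show ?thesis using H(3) hs by (simp add: v_def[abs_def])
  qed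
  ultimately obtain P where P: "P \<in> generated_algebra (matrix_coeffs T)" "P f0 \<noteq> 0"
    and Pv: "\<And>f. P f \<noteq> 0 \<Longrightarrow> independent_family B (\<lambda>b. v b f)"
    using independent_family_open[OF finB, of T v f0] by blast
  have "dim (weight_space T f a) = card {b\<in>B. w b = a}"
    if f: "f \<in> torus_embeddings T" and Pf: "P f \<noteq> 0" and a: "a \<in> Lie_p T" for f a
  proof (rule dim_weight_space[OF finB Pv[OF Pf] card])
    fix b assume b: "b \<in> B"
    show "v b f \<in> weight_space T f (w b)"
    proof (rule weight_spaceI_span[OF torus_subspace[OF T] H(5,3) embeddingD(1)[OF f] wd(1)[OF b]])
      fix h assume h: "h \<in> H"
      show "bracket (f h) (v b f) = scale (w b h) (v b f)"
        unfolding v_def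
        by (rule weight_projection)
          (use h hs wp[OF b] H(3,4) embedding_toral[OF f] embedding_commuting[OF T f] in \<open>auto simp: subset_iff\<close>)
    qed
    show "w b \<in> extensional T" using wd[OF b] by simp
  next
    show "a \<in> extensional T" using a by (simp add: Lie_p_def dual_space_def)
  qed
  then show ?thesis using P f0 by (intro bexI[of _ P]) auto
qed

lemma dim_weight_space_constant:
  assumes T: "torus T" and irr: "irreducible_space (torus_variety T)"
    and fg: "f \<in> torus_embeddings T" "g \<in> torus_embeddings T" and a: "a \<in> Lie_p T"
  shows "dim (weight_space T f a) = dim (weight_space T g a)"
proof -
  obtain P Q where P: "P \<in> generated_algebra (matrix_coeffs T)" "P f \<noteq> 0"
      "\<And>h. h \<in> torus_embeddings T \<Longrightarrow> P h \<noteq> 0 \<Longrightarrow> dim (weight_space T h a) = dim (weight_space T f a)"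
    and Q: "Q \<in> generated_algebra (matrix_coeffs T)" "Q g \<noteq> 0"
      "\<And>h. h \<in> torus_embeddings T \<Longrightarrow> Q h \<noteq> 0 \<Longrightarrow> dim (weight_space T h a) = dim (weight_space T g a)"
    using dim_weight_space_locally_constant[OF T fg(1)] dim_weight_space_locally_constant[OF T fg(2)] a
    by metis
  obtain h where "h \<in> torus_embeddings T" "P h \<noteq> 0" "Q h \<noteq> 0"
    using irreducible_common_nonzero[OF irr P(1) Q(1) fg(1) P(2) fg(2) Q(2)] by blast
  then show ?thesis using P(3) Q(3) by metis
qed

section \<open>Transvections of the torus\<close>

lemma Lie_pD:
  assumes "a \<in> Lie_p T"
  shows "a \<in> dual_space T" "t \<in> T \<Longrightarrow> a (pmap t) = a t ^ CHAR('k)"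
  using assms by (auto simp: Lie_p_def)

lemma Lie_p_toral:
  assumes "a \<in> Lie_p T" "h \<in> T" "toral h"
  shows "a h ^ CHAR('k) = a h"
  using Lie_pD(2)[OF assms(1,2)] assms(3) by (simp add: toral_def)

lemma Lie_p_nonzero_toral:
  assumes T: "torus T" and a: "a \<in> Lie_p T" "a \<noteq> (\<lambda>t\<in>T. 0)"
  shows "\<exists>h\<in>T. toral h \<and> a h \<noteq> 0"
proof (rule ccontr)
  assume "\<not> ?thesis"
  then have zero: "a h = 0" if "h \<in> T" "toral h" for h using that by blast
  note d = Lie_pD(1)[OF a(1)]
  have "t \<in> T \<and> a t = 0" if "t \<in> span {h\<in>T. toral h}" for t
    using that
  proof (induction rule: span_induct_alt)
    case base
    show ?case using dual_space_zero[OF d torus_subspace[OF T]] subspace_0[OF torus_subspace[OF T]] by simp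
  next
    case (step c h y)
    then have "scale c h \<in> T" using subspace_scale[OF torus_subspace[OF T]] by simp
    then show ?case using step subspace_add[OF torus_subspace[OF T]]
      by (simp add: dual_spaceD[OF d] zero)
  qed
  then have "a t = 0" if "t \<in> T" for t using that torus_eq_span_toral[OF T] by simp
  moreover have "a \<in> extensional T" using d by (simp add: dual_space_def)
  ultimately have "a = (\<lambda>t\<in>T. 0)" by (intro extensionalityI[of _ T]) auto
  then show False using a(2) by simp
qed

lemma toral_add: "toral x \<Longrightarrow> toral y \<Longrightarrow> bracket x y = 0 \<Longrightarrow> toral (x + y)"
  by (simp add: toral_def pmap_add_commuting)

text \<open>The toral elements on which a given nonzero form vanishes form a proper subgroup, and a group is not
the union of two proper subgroups. The value \<open>a(v)\<close> lies in the prime field, so \<open>v\<close> can be divided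
by it without ceasing to be toral.\<close>

lemma Lie_p_common_nonzero_toral:
  assumes T: "torus T" and a: "a \<in> Lie_p T" "a \<noteq> (\<lambda>t\<in>T. 0)" and b: "b \<in> Lie_p T" "b \<noteq> (\<lambda>t\<in>T. 0)"
  obtains u where "u \<in> T" "toral u" "a u = 1" "b u \<noteq> 0"
proof -
  note da = Lie_pD(1)[OF a(1)] and db = Lie_pD(1)[OF b(1)]
  obtain x where x: "x \<in> T" "toral x" "a x \<noteq> 0" using Lie_p_nonzero_toral[OF T a] by blast
  obtain y where y: "y \<in> T" "toral y" "b y \<noteq> 0" using Lie_p_nonzero_toral[OF T b] by blast
  have xy: "x + y \<in> T" "toral (x + y)"
    using x y subspace_add[OF torus_subspace[OF T]] commutingD[OF torus_commuting[OF T]]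
    by (auto intro: toral_add)
  have "\<exists>v\<in>T. toral v \<and> a v \<noteq> 0 \<and> b v \<noteq> 0"
  proof (cases "b x = 0 \<and> a y = 0")
    case True
    then have "a (x + y) \<noteq> 0" "b (x + y) \<noteq> 0"
      using x y by (simp_all add: dual_spaceD[OF da] dual_spaceD[OF db])
    then show ?thesis using xy by blast
  next
    case False
    then show ?thesis using x y by blast
  qed
  then obtain v where v: "v \<in> T" "toral v" "a v \<noteq> 0" "b v \<noteq> 0" by blast
  define u where "u = scale (inverse (a v)) v"
  have "inverse (a v) ^ CHAR('k) = inverse (a v)"
    using Lie_p_toral[OF a(1) v(1,2)] by (simp add: power_inverse)
  then have "toral u" using v(2) by (simp add: u_def toral_def pmap_scale)
  moreover have "u \<in> T" using v(1) subspace_scale[OF torus_subspace[OF T]] by (simp add: u_def)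
  moreover have "a u = 1" "b u \<noteq> 0"
    using v by (simp_all add: u_def dual_spaceD[OF da] dual_spaceD[OF db])
  ultimately show ?thesis using that by blast
qed

lemma torus_endomorphism_embedding:
  assumes T: "torus T" and f: "f \<in> extensional T" "\<And>x. x \<in> T \<Longrightarrow> f x \<in> T"
    and lin: "linear_on T scale scale f"
    and inj: "\<And>x. x \<in> T \<Longrightarrow> f x = 0 \<Longrightarrow> x = 0"
    and p: "\<And>x. x \<in> T \<Longrightarrow> f (pmap x) = pmap (f x)"
  shows "f \<in> torus_embeddings T"
proof -
  have H: "f \<in> Hom_k T" using f(1) lin by (simp add: Hom_k_def)
  note sT = torus_subspace[OF T] and cT = torus_commuting[OF T]
  have "inj_on f T"
  proof (rule inj_onI)
    fix x y assume xy: "x \<in> T" "y \<in> T" "f x = f y"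
    have m: "scale (-1) y \<in> T" using xy(2) sT by (simp only: subspace_scale)
    have "f (x + scale (-1) y) = f x + scale (-1) (f y)"
      using Hom_kD(2)[OF H xy(1) m] Hom_kD(1)[OF H xy(2), of "-1"] by (simp only:)
    then have "f (x + scale (-1) y) = 0" using xy(3) by simp
    then have "x + scale (-1) y = 0" using inj subspace_add[OF sT xy(1) m] by blast
    then show "x = y" by simp
  qed
  moreover have "f (bracket x y) = bracket (f x) (f y)" if "x \<in> T" "y \<in> T" for x y
    using that commutingD[OF cT] f(2) Hom_k_zero[OF H sT] by simp
  ultimately show ?thesis using H p by (simp add: torus_embeddings_def)
qed

lemma scalar_embedding:
  assumes T: "torus T" and c: "c ^ CHAR('k) = c" "c \<noteq> 0"
  shows "(\<lambda>t\<in>T. scale c t) \<in> torus_embeddings T"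
proof (rule torus_endomorphism_embedding[OF T])
  note sT = torus_subspace[OF T]
  show "linear_on T scale scale (\<lambda>t\<in>T. scale c t)"
    using sT by (auto simp: linear_on_def subspace_add subspace_scale scale_right_distrib mult.commute)
qed (use torus_subspace[OF T] torus_pmap[OF T] c in \<open>auto simp: subspace_scale pmap_scale\<close>)

lemma transvection_embedding:
  assumes T: "torus T" and l: "l \<in> Lie_p T" and u: "u \<in> T" "toral u" "1 + l u \<noteq> 0"
  shows "(\<lambda>t\<in>T. t + scale (l t) u) \<in> torus_embeddings T"
proof (rule torus_endomorphism_embedding[OF T])
  note sT = torus_subspace[OF T] and d = Lie_pD(1)[OF l] and cT = torus_commuting[OF T]
  have lu: "scale c u \<in> T" for c using u(1) sT by (rule subspace_scale[rotated])
  show "linear_on T scale scale (\<lambda>t\<in>T. t + scale (l t) u)"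
    using sT by (auto simp: linear_on_def subspace_add subspace_scale scale_right_distrib
        scale_left_distrib dual_spaceD[OF d])
  show "(\<lambda>t\<in>T. t + scale (l t) u) x \<in> T" if "x \<in> T" for x
    using that lu sT by (simp add: subspace_add)
  show "x = 0" if x: "x \<in> T" "(\<lambda>t\<in>T. t + scale (l t) u) x = 0" for x
  proof -
    have "x = scale (- l x) u" using x by (simp add: add_eq_0_iff)
    then have "l x = - l x * l u" using dual_spaceD(1)[OF d u(1), of "- l x"] by metis
    then have "l x = - (l x * l u)" by (simp only: mult_minus_left)
    then have "l x * (1 + l u) = 0" by (simp only: distrib_left mult_1_right eq_neg_iff_add_eq_0)
    then have "l x = 0" using u(3) by simp
    then show ?thesis using \<open>x = scale (- l x) u\<close> by simp
  qed
  show "(\<lambda>t\<in>T. t + scale (l t) u) (pmap x) = pmap ((\<lambda>t\<in>T. t + scale (l t) u) x)" if x: "x \<in> T" for x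
    using x torus_pmap[OF T x] u(2) Lie_pD(2)[OF l x] commutingD[OF cT x lu]
    by (simp add: pmap_add_commuting pmap_scale toral_def)
qed auto

lemma Lie_p_diff:
  assumes T: "torus T" and a: "a \<in> Lie_p T" and b: "b \<in> Lie_p T"
  shows "(\<lambda>t\<in>T. b t - a t) \<in> Lie_p T"
proof -
  note sT = torus_subspace[OF T]
  have "(b t - a t) ^ CHAR('k) = b t ^ CHAR('k) - a t ^ CHAR('k)" for t
    using frobenius_add[of "b t" "- a t"] by (simp add: frobenius_minus)
  then show ?thesis
    using sT torus_pmap[OF T] Lie_pD[OF a] Lie_pD[OF b]
    by (auto simp: Lie_p_def dual_space_def linear_on_def subspace_add subspace_scale algebra_simps)
qed

text \<open>For the transvection \<open>f(t) = t + (b - a)(t) u\<close> one has \<open>a \<circ> f = b\<close> since \<open>a(u) = 1\<close>; it is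
invertible since \<open>1 + (b - a)(u) = b(u) \<noteq> 0\<close>. Hence the weight space of weight \<open>b\<close> for \<open>f\<close> is the
root space of \<open>a\<close>, whereas for the inclusion it is the root space of \<open>b\<close>.\<close>

lemma dim_root_space_eq:
  assumes T: "torus T" and irr: "irreducible_space (torus_variety T)"
    and a: "a \<in> Lie_p T" "a \<noteq> (\<lambda>t\<in>T. 0)" and b: "b \<in> Lie_p T" "b \<noteq> (\<lambda>t\<in>T. 0)"
  shows "dim (root_space T a) = dim (root_space T b)"
proof -
  obtain u where u: "u \<in> T" "toral u" "a u = 1" "b u \<noteq> 0"
    using Lie_p_common_nonzero_toral[OF T a b] .
  define l where "l = (\<lambda>t\<in>T. b t - a t)"
  define f where "f = (\<lambda>t\<in>T. t + scale (l t) u)"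
  have l: "l \<in> Lie_p T" unfolding l_def by (rule Lie_p_diff[OF T a(1) b(1)])
  have lu: "1 + l u = b u" using u by (simp add: l_def)
  have f: "f \<in> torus_embeddings T"
    unfolding f_def by (rule transvection_embedding[OF T l u(1,2)]) (simp add: lu u(4))
  have id: "(\<lambda>t\<in>T. scale 1 t) \<in> torus_embeddings T" by (rule scalar_embedding[OF T]) simp_all
  have br: "bracket (f t) x = bracket t x + scale (l t) (bracket u x)" if "t \<in> T" for t x
    using that by (simp add: f_def bracket_left.add bracket_left.scale)
  have "weight_space T f b = root_space T a"
  proof (intro equalityI subsetI)
    fix x assume x: "x \<in> root_space T a"
    have "bracket (f t) x = scale (b t) x" if t: "t \<in> T" for t
      using x t u(1,3) by (simp add: br root_space_def scale_left_distrib[symmetric] l_def)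
    then show "x \<in> weight_space T f b" by (simp add: weight_space_def)
  next
    fix x assume "x \<in> weight_space T f b"
    then have x: "bracket t x + scale (l t) (bracket u x) = scale (b t) x" if "t \<in> T" for t
      using that br by (simp add: weight_space_def)
    have "scale (b u) (bracket u x) = bracket u x + scale (l u) (bracket u x)"
      by (simp add: lu[symmetric] scale_left_distrib)
    then have "scale (b u) (bracket u x) = scale (b u) x" using x[OF u(1)] by simp
    then have ux: "bracket u x = x" using u(4) by simp
    have "bracket t x = scale (a t) x" if t: "t \<in> T" for t
    proof -
      have "bracket t x = scale (b t) x - scale (l t) x" using x[OF t] ux by (simp add: eq_diff_eq)
      then show ?thesis using t by (simp add: l_def scale_left_diff_distrib)
    qed
    then show "x \<in> root_space T a" by (simp add: root_space_def)
  qed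
  then have "dim (root_space T a) = dim (weight_space T f b)" by simp
  also have "\<dots> = dim (weight_space T (\<lambda>t\<in>T. scale 1 t) b)"
    by (rule dim_weight_space_constant[OF T irr f id b(1)])
  also have "weight_space T (\<lambda>t\<in>T. scale 1 t) b = root_space T b"
    by (rule root_space_eq_weight_space[symmetric]) simp
  finally show ?thesis .
qed

section \<open>Central tori\<close>

text \<open>Adjoining the toral element \<open>f(t)\<close>, which commutes with the central \<open>T\<close>, to the toral elements of
\<open>T\<close> spans a torus containing \<open>T\<close>. By the maximality of \<open>dim T\<close> it equals \<open>T\<close>.\<close>

lemma embedding_central_maximal_torus:
  assumes T: "torus_of_max_dim T" and central: "\<And>t x. t \<in> T \<Longrightarrow> bracket t x = 0"
    and f: "f \<in> torus_embeddings T" and t: "t \<in> T" "toral t"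
  shows "f t \<in> T"
proof -
  have T': "torus T" and max: "dim T = max_torus_dim" using T by (auto simp: torus_of_max_dim_def)
  define S where "S = {h\<in>T. toral h} \<union> {f t}"
  have "torus (span S)"
  proof (rule torus_span_toral)
    have "bracket x h = 0" if "h \<in> T" for h x
      using central[OF that, of x] bracket_anticomm[of x h] by simp
    then show "commuting S" using central bracket_self by (auto simp: S_def commuting_def)
    show "toral h" if "h \<in> S" for h using that embedding_toral[OF f t] by (auto simp: S_def)
  qed
  moreover have "finite (dim ` {T. torus T})"
    by (rule finite_subset[of _ "{..dimension}"]) (auto simp: dim_subset_UNIV)
  ultimately have "dim (span S) \<le> dim T"
    unfolding max max_torus_dim_def by (intro Max_ge) (auto simp del: dim_span)
  moreover have "T \<subseteq> span S"
    using torus_eq_span_toral[OF T'] span_mono[of "{h\<in>T. toral h}" S] by (auto simp: S_def)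
  ultimately have "T = span S"
    by (intro subspace_dim_equal torus_subspace[OF T'] subspace_span)
  moreover have "f t \<in> span S" by (simp add: S_def span_base)
  ultimately show ?thesis by blast
qed

text \<open>Choose a toral \<open>h\<close> with \<open>c = a(h) \<noteq> 0\<close>. For every embedding \<open>f\<close> the scalar \<open>a(f(h))\<close> lies in the
prime field, and so does \<open>Q(f) = a(f(h)) - c\<close>; thus \<open>P(f) = c\<^bsup>p-1\<^esup> - Q(f)\<^bsup>p-1\<^esup> = 1 - Q(f)\<^bsup>p-1\<^esup>\<close>
is zero exactly where \<open>Q(f)\<close> is not. Hence \<open>PQ = 0\<close>, although \<open>P(id) = 1\<close> and
\<open>Q(-id) = -2c \<noteq> 0\<close>, as \<open>p \<noteq> 2\<close>.\<close>

lemma central_torus_reducible: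
  assumes p: "CHAR('k) \<ge> 3" and T: "torus_of_max_dim T"
    and central: "\<And>t x. t \<in> T \<Longrightarrow> bracket t x = 0"
    and a: "a \<in> Lie_p T" "a \<noteq> (\<lambda>t\<in>T. 0)"
  shows "\<not> irreducible_space (torus_variety T)"
proof
  assume irr: "irreducible_space (torus_variety T)"
  have T': "torus T" using T by (simp add: torus_of_max_dim_def)
  note d = Lie_pD(1)[OF a(1)]
  obtain h where h: "h \<in> T" "toral h" "a h \<noteq> 0" using Lie_p_nonzero_toral[OF T' a] by blast
  define c where "c = a h"
  have c: "c ^ CHAR('k) = c" "c \<noteq> 0"
    using Lie_p_toral[OF a(1) h(1,2)] h(3) by (simp_all add: c_def)
  obtain H where H: "independent H" "H \<subseteq> T" "T = span H" using torus_toral_basis[OF T'] by metis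
  \<comment> \<open>The coordinate functions come from linear forms on the whole algebra, so \<open>a\<close> must be extended.\<close>
  obtain \<xi> where \<xi>: "Vector_Spaces.linear scale (*) \<xi>" "\<And>x. x \<in> H \<Longrightarrow> \<xi> x = a x"
    using functionals.linear_independent_extend[OF H(1), of a] by blast
  have \<xi>a: "\<xi> t = a t" if "t \<in> T" for t
  proof -
    have "t \<in> T \<and> \<xi> t = a t" if "t \<in> span H" for t
      using that
    proof (induction rule: span_induct_alt)
      case base
      show ?case using functionals.linear_0[OF \<xi>(1)] dual_space_zero[OF d torus_subspace[OF T']]
          subspace_0[OF torus_subspace[OF T']] by simp
    next
      case (step r x y)
      then have "x \<in> T" "scale r x \<in> T"
        using H(2) subspace_scale[OF torus_subspace[OF T']] by auto
      then show ?case using step subspace_add[OF torus_subspace[OF T']] \<xi>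
        by (simp add: dual_spaceD[OF d] functionals.linear_add functionals.linear_scale)
    qed
    then show ?thesis using that H(3) by blast
  qed
  define Q where "Q f = \<xi> (f h) - c" for f
  define P where "P f = c ^ (CHAR('k) - 1) - Q f ^ (CHAR('k) - 1)" for f
  have "(\<lambda>f. \<xi> (f h)) \<in> generated_algebra (matrix_coeffs T)"
    using \<xi>(1) h(1) by (intro generated_algebra.gen) (auto simp: matrix_coeffs_def)
  then have Q: "Q \<in> generated_algebra (matrix_coeffs T)"
    unfolding Q_def[abs_def] by (intro generated_algebra_diff generated_algebra.const)
  then have P: "P \<in> generated_algebra (matrix_coeffs T)"
    unfolding P_def[abs_def] by (intro generated_algebra_diff generated_algebra_power generated_algebra.const)
  have PQ: "P f = 0 \<or> Q f = 0" if f: "f \<in> torus_embeddings T" for f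
  proof -
    have fh: "f h \<in> T" by (rule embedding_central_maximal_torus[OF T central f h(1,2)])
    have "\<xi> (f h) ^ CHAR('k) = \<xi> (f h)"
      using Lie_p_toral[OF a(1) fh embedding_toral[OF f h(1,2)]] \<xi>a[OF fh] by simp
    then have "Q f ^ CHAR('k) = Q f"
      using frobenius_add[of "\<xi> (f h)" "- c"] c(1) by (simp add: Q_def frobenius_minus)
    then show ?thesis using prime_field_power[of "Q f"] prime_field_power[OF c] by (auto simp: P_def)
  qed
  have "P (\<lambda>t\<in>T. scale 1 t) \<noteq> 0"
    using h(1) \<xi>a c(2) p by (simp add: P_def Q_def c_def zero_power)
  moreover have "Q (\<lambda>t\<in>T. scale (- 1) t) \<noteq> 0"
  proof -
    have "Q (\<lambda>t\<in>T. scale (- 1) t) = - (of_nat 2 * c)"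
      using h(1) \<xi>a \<xi>(1) by (simp add: Q_def c_def functionals.linear_neg)
    moreover have "of_nat 2 \<noteq> (0 :: 'k)"
      unfolding of_nat_eq_0_iff_char_dvd using p by (auto dest: dvd_imp_le)
    ultimately show ?thesis using c(2) by simp
  qed
  moreover have "(\<lambda>t\<in>T. scale 1 t) \<in> torus_embeddings T"
    by (rule scalar_embedding[OF T']) simp_all
  moreover have "(\<lambda>t\<in>T. scale (- 1) t) \<in> torus_embeddings T"
    by (rule scalar_embedding[OF T']) (simp_all add: frobenius_minus)
  ultimately obtain f where "f \<in> torus_embeddings T" "P f \<noteq> 0" "Q f \<noteq> 0"
    using irreducible_common_nonzero[OF irr P Q] by blast
  then show False using PQ by blast
qed

section \<open>Roots\<close>

lemma root_in_Lie_p: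
  assumes T: "torus T" and a: "a \<in> roots T"
  shows "a \<in> Lie_p T"
proof -
  have "0 \<in> root_space T a" by (simp add: root_space_def ad.zero)
  then obtain x where "x \<noteq> 0" "x \<in> root_space T a" using a by (auto simp: roots_def)
  then show ?thesis
    using a torus_pmap[OF T] root_space_eq_weight_space[of T "\<lambda>t. t" a]
    by (intro weight_in_Lie_p[of T "\<lambda>t. t" a x]) (auto simp: roots_def)
qed

text \<open>The algebra is spanned by weight vectors, and without roots all of them have weight zero.\<close>

lemma no_roots_central:
  assumes T: "torus T" and "roots T = {}" and t: "t \<in> T"
  shows "bracket t x = 0"
proof -
  let ?id = "\<lambda>t\<in>T. scale 1 t"
  have id: "?id \<in> torus_embeddings T" by (rule scalar_embedding[OF T]) simp_all
  have "x \<in> span (\<Union>a\<in>Lie_p T. weight_space T ?id a)"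
    using weight_spaces_span[OF T id] by simp
  then show ?thesis
  proof (induction rule: span_induct_alt)
    case base
    show ?case by (rule ad.zero)
  next
    case (step c x y)
    then obtain a where a: "a \<in> Lie_p T" "x \<in> weight_space T ?id a" by blast
    have "bracket t x = scale (a t) x" using a(2) t by (simp add: weight_space_def)
    moreover have "a t = 0 \<or> x = 0"
    proof (cases "a = (\<lambda>t\<in>T. 0)")
      case False
      then have "root_space T a = {0}" using assms(2) Lie_pD(1)[OF a(1)] by (auto simp: roots_def)
      then show ?thesis using a(2) root_space_eq_weight_space[of T ?id a] by simp
    qed (simp add: t)
    ultimately show ?case using step by (auto simp: ad.add ad.scale)
  qed
qed

theorem roots_of_irreducible_torus_variety:
  assumes p: "CHAR('k) \<ge> 3" and T: "torus_of_max_dim T" and irr: "irreducible_space (torus_variety T)"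
  shows "roots T \<union> {\<lambda>t\<in>T. 0} = Lie_p T"
    and "a \<in> roots T \<Longrightarrow> b \<in> roots T \<Longrightarrow> dim (root_space T a) = dim (root_space T b)"
proof -
  have T': "torus T" using T by (simp add: torus_of_max_dim_def)
  show "dim (root_space T a) = dim (root_space T b)" if "a \<in> roots T" "b \<in> roots T"
    using that root_in_Lie_p[OF T'] by (intro dim_root_space_eq[OF T' irr]) (auto simp: roots_def)
  have "(\<lambda>t\<in>T. 0) \<in> Lie_p T"
    using torus_subspace[OF T'] torus_pmap[OF T'] char_pos
    by (auto simp: Lie_p_def dual_space_def linear_on_def subspace_add subspace_scale zero_power)
  moreover have "b \<in> roots T" if b: "b \<in> Lie_p T" "b \<noteq> (\<lambda>t\<in>T. 0)" for b
  proof -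
    have "roots T \<noteq> {}"
      using central_torus_reducible[OF p T no_roots_central[OF T'] b] irr by blast
    then obtain a where a: "a \<in> roots T" by blast
    have "0 \<in> root_space T a" by (simp add: root_space_def ad.zero)
    then have "\<not> root_space T a \<subseteq> {0}" using a by (auto simp: roots_def)
    then have "dim (root_space T a) \<noteq> 0" by (simp only: dim_eq_0 not_False_eq_True)
    then have "dim (root_space T b) \<noteq> 0"
      using dim_root_space_eq[OF T' irr root_in_Lie_p[OF T' a] _ b] a by (simp add: roots_def del: dim_eq_0)
    then show ?thesis using b Lie_pD(1)[OF b(1)] by (auto simp: roots_def)
  qed
  ultimately show "roots T \<union> {\<lambda>t\<in>T. 0} = Lie_p T"
    using root_in_Lie_p[OF T'] by blast
qed

end

theorem corollary6p1p3:
  fixes scale :: "'k::alg_closed_field \<Rightarrow> 'g::ab_group_add \<Rightarrow> 'g"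
    and bracket :: "'g \<Rightarrow> 'g \<Rightarrow> 'g"
    and pmap :: "'g \<Rightarrow> 'g"
    and Basis :: "'g set"
    and T :: "'g set"
  assumes "CHAR('k) \<ge> 3"
    and "restricted_lie_algebra scale bracket pmap"
    and "finite_dimensional_vector_space scale Basis"
    and "restricted_lie_algebra.torus_of_max_dim scale bracket pmap T"
    and "irreducible_space (restricted_lie_algebra.torus_variety scale bracket pmap T)"
  shows "restricted_lie_algebra.roots scale bracket T \<union> {\<lambda>t\<in>T. 0}
           = restricted_lie_algebra.Lie_p scale pmap T
       \<and> (\<forall>a \<in> restricted_lie_algebra.roots scale bracket T.
           \<forall>b \<in> restricted_lie_algebra.roots scale bracket T.
             vector_space.dim scale (restricted_lie_algebra.root_space scale bracket T a)
           = vector_space.dim scale (restricted_lie_algebra.root_space scale bracket T b))"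
proof -
  interpret alg_closed_restricted_lie_algebra scale bracket pmap Basis
    using assms(2,3) by (rule alg_closed_restricted_lie_algebra.intro)
  show ?thesis
    using roots_of_irreducible_torus_variety[OF assms(1,4,5)] by blast
qed

end
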